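(* Let $F:\mathbb{R}^d\to\mathbb{R}^d$ be $L$-Lipschitz and suppose that $u^*\in\mathbb{R}^d$ is a weak Minty solution for $F$ with parameter $\rho>0$, where $\frac1L>\rho$. Let $(u_k)_{k\ge0}$ be the sequence of iterates generated by stochastic OGDA$+$, with step size $a$ and parameter $\gamma$ satisfying $$\rho<a<\frac{1-\gamma}{1+\gamma}\,\frac1L ,$$ using a stochastic oracle $\tilde F$ that is unbiased and has variance bounded by $\sigma^2$. Then, to visit an $\varepsilon$-stationary point, i.e. such that $$\min_{i=0,\dots,k-1}\mathbb{E}\big[\Vert F(u_i)\Vert^2\big]\le\varepsilon ,$$ we require $$\mathcal{O}\left(\frac1\varepsilon\,\frac{1}{a\gamma(a-\rho)}\,\mathbb{E}\big[\Vert u_0+a\tilde g_0-u^*\Vert^2\big]\,\max\left\{1,\frac{4\sigma^2}{aL}\,\frac1\varepsilon\right\}\right)$$ calls to the stochastic oracle $\tilde F$, with large batch sizes of order $\mathcal{O}(\varepsilon^{-1})$.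
   Context: $\langle\cdot,\cdot\rangle$ and $\Vert\cdot\Vert$ are the Euclidean inner product and norm on $\mathbb{R}^d$. Weak Minty solution: $u^*\in\mathbb{R}^d$ is a weak Minty solution for $F$ with parameter $\rho>0$ if $\langle F(u),u-u^*\rangle\ge-\frac{\rho}{2}\Vert F(u)\Vert^2$ for all $u\in\mathbb{R}^d$. Stochastic OGDA$+$: given a starting point $u_0=u_{-1}\in\mathbb{R}^d$, step size $a>0$, parameter $0<\gamma\le1$ and batch size $B$, for $k=0,1,\dots$ sample i.i.d. $(\xi_i)_{i=1}^B$, compute the estimator $\tilde g_k=\frac1B\sum_{i=1}^B\tilde F(u_k,\xi_i)$, and set $u_{k+1}=u_k-a\big((1+\gamma)\tilde g_k-\tilde g_{k-1}\big)$. Here $\tilde g_{-1}$ denotes the estimator at $u_{-1}=u_0$. Each evaluation of $\tilde F(u_k,\xi_i)$ is one call to the stochastic oracle. Oracle assumptions: instead of the exact operator $F$ one has access, at every iteration, to a collection of independent estimators $\tilde F(\cdot,\xi_i)$ that are unbiased, $\mathbb{E}[\tilde F(u_k,\xi_i)\mid u_k]=F(u_k)$, and have bounded variance, $\mathbb{E}[\Vert\tilde F(u_k,\xi_i)-F(u_k)\Vert^2]\le\sigma^2$.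
   Formalization: The constant in O(...) may depend on an upper bound q<1 for aL (and is for fixed d and sample spaces); an absolute constant fails as γ→0 with aL→1. The bound is proved for all instances, counting the calls needed to reach the last visited iterate. *)

theory Defs
  imports "HOL-Probability.Probability" "HOL-Library.Landau_Symbols"
begin

definition weak_minty_solution ::
  "('a::euclidean_space \<Rightarrow> 'a) \<Rightarrow> real \<Rightarrow> 'a \<Rightarrow> bool" where
  "weak_minty_solution F \<rho> ustar \<longleftrightarrow>
     \<rho> > 0 \<and> (\<forall>u. F u \<bullet> (u - ustar) \<ge> - (\<rho> / 2) * (norm (F u))\<^sup>2)"

text \<open>\<open>\<xi> k i\<close> is the \<open>i\<close>-th sample drawn in iteration \<open>k\<close>, with common law \<open>D\<close>. Fresh samples
  are drawn in every iteration, so the whole family is independent. A run with batch size \<open>B\<close>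
  uses only the indices \<open>i < B\<close>.\<close>

definition iid_samples ::
  "'w measure \<Rightarrow> 's measure \<Rightarrow> (nat \<Rightarrow> nat \<Rightarrow> 'w \<Rightarrow> 's) \<Rightarrow> bool" where
  "iid_samples M D \<xi> \<longleftrightarrow>
     prob_space M \<and>
     prob_space.indep_vars M (\<lambda>_. D) (\<lambda>(k, i). \<xi> k i) UNIV \<and>
     (\<forall>k i. distr M D (\<xi> k i) = D)"

definition batch_estimator ::
  "('a::euclidean_space \<Rightarrow> 's \<Rightarrow> 'a) \<Rightarrow> (nat \<Rightarrow> nat \<Rightarrow> 'w \<Rightarrow> 's) \<Rightarrow> nat \<Rightarrow> nat \<Rightarrow> 'a \<Rightarrow> 'w \<Rightarrow> 'a" where
  "batch_estimator Ft \<xi> B k x \<omega> = (1 / real B) *\<^sub>R (\<Sum>i<B. Ft x (\<xi> k i \<omega>))"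

text \<open>Stochastic OGDA+. Since \<open>u\<^sub>-\<^sub>1 = u\<^sub>0\<close>, the estimator \<open>g\<^sub>-\<^sub>1\<close> at \<open>u\<^sub>-\<^sub>1\<close> is the estimator \<open>g\<^sub>0\<close>
  at \<open>u\<^sub>0\<close>; this is the second equation.\<close>

fun ogda_plus ::
  "('a::euclidean_space \<Rightarrow> 's \<Rightarrow> 'a) \<Rightarrow> (nat \<Rightarrow> nat \<Rightarrow> 'w \<Rightarrow> 's) \<Rightarrow> real \<Rightarrow> real \<Rightarrow> 'a \<Rightarrow> nat \<Rightarrow> nat \<Rightarrow> 'w \<Rightarrow> 'a" where
  "ogda_plus Ft \<xi> a \<gamma> u0 B 0 \<omega> = u0"
| "ogda_plus Ft \<xi> a \<gamma> u0 B (Suc 0) \<omega> =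
     u0 - a *\<^sub>R ((1 + \<gamma>) *\<^sub>R batch_estimator Ft \<xi> B 0 u0 \<omega> - batch_estimator Ft \<xi> B 0 u0 \<omega>)"
| "ogda_plus Ft \<xi> a \<gamma> u0 B (Suc (Suc k)) \<omega> =
     ogda_plus Ft \<xi> a \<gamma> u0 B (Suc k) \<omega> -
     a *\<^sub>R ((1 + \<gamma>) *\<^sub>R batch_estimator Ft \<xi> B (Suc k) (ogda_plus Ft \<xi> a \<gamma> u0 B (Suc k) \<omega>) \<omega> -
          batch_estimator Ft \<xi> B k (ogda_plus Ft \<xi> a \<gamma> u0 B k \<omega>) \<omega>)"

text \<open>\<open>E[X | Y] = Z\<close> almost surely for vector-valued \<open>X\<close>, coordinate by coordinate, because
  \<^const>\<open>real_cond_exp\<close> is only available for real-valued functions.\<close>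

definition cond_expectation_eq ::
  "'w measure \<Rightarrow> ('w \<Rightarrow> 'a::euclidean_space) \<Rightarrow> ('w \<Rightarrow> 'a) \<Rightarrow> ('w \<Rightarrow> 'a) \<Rightarrow> bool" where
  "cond_expectation_eq M X Y Z \<longleftrightarrow>
     integrable M X \<and>
     (\<forall>b\<in>Basis. AE \<omega> in M.
        real_cond_exp M (vimage_algebra (space M) Y borel) (\<lambda>\<omega>. X \<omega> \<bullet> b) \<omega> = Z \<omega> \<bullet> b)"

text \<open>Unbiasedness and bounded variance are required along the iterates only, for the run with
  each batch size \<open>B\<close>. Integrability of the squared deviation excludes an infinite variance, for
  which the Bochner integral would be 0.\<close>

definition stochastic_oracle ::
  "'w measure \<Rightarrow> 's measure \<Rightarrow> (nat \<Rightarrow> nat \<Rightarrow> 'w \<Rightarrow> 's) \<Rightarrow> ('a::euclidean_space \<Rightarrow> 's \<Rightarrow> 'a) \<Rightarrow>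
   ('a \<Rightarrow> 'a) \<Rightarrow> real \<Rightarrow> (nat \<Rightarrow> nat \<Rightarrow> 'w \<Rightarrow> 'a) \<Rightarrow> bool" where
  "stochastic_oracle M D \<xi> Ft F \<sigma> u \<longleftrightarrow>
     iid_samples M D \<xi> \<and>
     (\<lambda>(x, s). Ft x s) \<in> borel_measurable (borel \<Otimes>\<^sub>M D) \<and>
     (\<forall>B\<ge>1. \<forall>k. \<forall>i<B.
        cond_expectation_eq M (\<lambda>\<omega>. Ft (u B k \<omega>) (\<xi> k i \<omega>)) (u B k) (\<lambda>\<omega>. F (u B k \<omega>)) \<and>
        integrable M (\<lambda>\<omega>. (norm (Ft (u B k \<omega>) (\<xi> k i \<omega>) - F (u B k \<omega>)))\<^sup>2) \<and>
        (\<integral>\<omega>. (norm (Ft (u B k \<omega>) (\<xi> k i \<omega>) - F (u B k \<omega>)))\<^sup>2 \<partial>M) \<le> \<sigma>\<^sup>2)"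

text \<open>Oracle calls needed to reach the iterate \<open>u\<^sub>n\<close> with batch size \<open>B\<close>: the evaluations of
  \<open>Ft (u\<^sub>j) (\<xi> j i)\<close> for \<open>j < n\<close> and \<open>i < B\<close>. In particular \<open>u\<^sub>0\<close> is available without any call.\<close>

definition oracle_calls :: "nat \<Rightarrow> nat \<Rightarrow> nat" where
  "oracle_calls B n = card ({..<n} \<times> {..<B})"

end

theory Submission
  imports Defs
begin

text \<open>Put \<open>z\<^sub>k = u\<^sub>k + a g\<^sub>k\<^sub>-\<^sub>1\<close>, so that \<open>z\<^sub>k\<^sub>+\<^sub>1 = z\<^sub>k - a \<gamma> g\<^sub>k\<close>. Expanding \<open>\<parallel>z\<^sub>k\<^sub>+\<^sub>1 - u\<^sup>*\<parallel>\<^sup>2\<close>, polarizing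
  \<open>g\<^sub>k \<bullet> g\<^sub>k\<^sub>-\<^sub>1\<close> and using the weak Minty inequality bounds its growth by \<open>\<rho> \<phi>\<^sub>k\<close> plus \<open>a\<close> times
  \<open>\<delta>\<^sub>k - (1 - \<gamma>) \<phi>\<^sub>k - \<phi>\<^sub>k\<^sub>-\<^sub>1\<close> plus noise, where \<open>\<phi>\<^sub>k = E \<parallel>F u\<^sub>k\<parallel>\<^sup>2\<close> and
  \<open>\<delta>\<^sub>k = E \<parallel>F u\<^sub>k - F u\<^sub>k\<^sub>-\<^sub>1\<parallel>\<^sup>2\<close>. By the Lipschitz condition \<open>\<delta>\<close> contracts up to a multiple of \<open>\<phi>\<close>. After
  summation the coefficient of each \<open>\<phi>\<^sub>k\<close> is at least \<open>(a - \<rho>) + a (a L) (1 - a L)\<close>. The first part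
  gives the iteration count, and the second part absorbs a noise of variance \<open>\<sigma>\<^sup>2 / B\<close> as soon as \<open>B\<close> is
  of order \<open>\<sigma>\<^sup>2 / (a L \<epsilon>)\<close>; this is where the factor \<open>4 \<sigma>\<^sup>2 / (a L \<epsilon>)\<close> comes from and why the constant
  depends on a bound \<open>q < 1\<close> for \<open>a L\<close>. The telescoped sum misses one \<open>\<phi>\<close>-term at its end, which is
  dominated by \<open>\<parallel>z - u\<^sup>*\<parallel>\<^sup>2\<close> because \<open>\<rho> < 1 / L\<close> forces \<open>F u\<^sup>* = 0\<close>.\<close>

section \<open>Weak Minty solutions and square integrable functions\<close>

text \<open>Evaluate the Minty inequality at the fixed point of \<open>x \<mapsto> u\<^sup>* - \<rho> F x\<close>.\<close>

lemma weak_minty_zero: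
  fixes F :: "'a::euclidean_space \<Rightarrow> 'a"
  assumes lip: "L-lipschitz_on UNIV F" and wm: "weak_minty_solution F \<rho> ustar"
    and L: "\<rho> < 1 / L"
  shows "F ustar = 0"
proof -
  have \<rho>: "\<rho> > 0" and minty: "\<And>u. F u \<bullet> (u - ustar) \<ge> - (\<rho> / 2) * (norm (F u))\<^sup>2"
    using wm by (auto simp: weak_minty_solution_def)
  have "L > 0" using L \<rho> lipschitz_on_nonneg[OF lip] by (cases "L = 0") auto
  then have rL: "\<rho> * L < 1" "0 \<le> \<rho> * L" using L \<rho> by (auto simp: field_simps)
  have "dist (ustar - \<rho> *\<^sub>R F x) (ustar - \<rho> *\<^sub>R F y) \<le> \<rho> * L * dist x y" for x y
  proof -
    have "dist (ustar - \<rho> *\<^sub>R F x) (ustar - \<rho> *\<^sub>R F y) = \<rho> * dist (F x) (F y)"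
      using \<rho> by (simp add: dist_norm norm_minus_commute flip: scaleR_diff_right)
    also have "\<dots> \<le> \<rho> * (L * dist x y)"
      using \<rho> lipschitz_onD[OF lip, of x y] by (intro mult_left_mono) auto
    finally show ?thesis by (simp add: mult_ac)
  qed
  then have "\<exists>!x. ustar - \<rho> *\<^sub>R F x = x"
    using rL by (intro banach_fix_type) auto
  then obtain x where x: "x - ustar = - (\<rho> *\<^sub>R F x)" by (metis add_diff_cancel_left' diff_add_cancel minus_diff_eq)
  \<comment> \<open>At the fixed point the Minty product is
    \<open>- \<rho> * (norm (F x))\<^sup>2\<close>, twice as negative as permitted. Hence
    \<open>F x = 0\<close>, and then \<open>x = ustar\<close>.\<close>
  have "- \<rho> * (norm (F x))\<^sup>2 \<ge> - (\<rho> / 2) * (norm (F x))\<^sup>2"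
    using minty[of x] unfolding x by (simp add: power2_norm_eq_inner)
  then have "\<rho> * (norm (F x))\<^sup>2 \<le> 0" by simp
  then have "F x = 0" using \<rho> by (simp add: mult_le_0_iff)
  then show ?thesis using x by simp
qed

text \<open>Measurability is asked of \<open>X\<close> itself because integrability of the squared
  norm only yields measurability of that real function.\<close>

definition square_integrable :: "'w measure \<Rightarrow> ('w \<Rightarrow> 'a::euclidean_space) \<Rightarrow> bool" where
  "square_integrable M X \<longleftrightarrow> X \<in> borel_measurable M \<and> integrable M (\<lambda>\<omega>. (norm (X \<omega>))\<^sup>2)"

text \<open>The inner product of L2, taken on functions rather than classes. Additivity needs square
  integrability, since the Bochner integral of a non-integrable function is 0.\<close>

definition ip :: "'w measure \<Rightarrow> ('w \<Rightarrow> 'a::euclidean_space) \<Rightarrow> ('w \<Rightarrow> 'a) \<Rightarrow> real" where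
  "ip M X Y = (\<integral>\<omega>. X \<omega> \<bullet> Y \<omega> \<partial>M)"

lemma square_integrable_measurable: "square_integrable M X \<Longrightarrow> X \<in> borel_measurable M"
  by (simp add: square_integrable_def)

lemma integrable_inner_square_integrable:
  fixes X Y :: "'w \<Rightarrow> 'a::euclidean_space"
  assumes "square_integrable M X" "square_integrable M Y"
  shows "integrable M (\<lambda>\<omega>. X \<omega> \<bullet> Y \<omega>)"
proof (rule Bochner_Integration.integrable_bound)
  show "integrable M (\<lambda>\<omega>. (norm (X \<omega>))\<^sup>2 + (norm (Y \<omega>))\<^sup>2)"
    using assms by (simp add: square_integrable_def)
  show "(\<lambda>\<omega>. X \<omega> \<bullet> Y \<omega>) \<in> borel_measurable M"
    using assms by (auto simp: square_integrable_def)
  have "\<bar>x \<bullet> y\<bar> \<le> (norm x)\<^sup>2 + (norm y)\<^sup>2" for x y :: 'a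
  proof -
    have "2 * (norm x * norm y) \<le> (norm x)\<^sup>2 + (norm y)\<^sup>2"
      using sum_squares_bound[of "norm x" "norm y"] by (simp add: mult_ac)
    moreover have "0 \<le> norm x * norm y" by simp
    ultimately show ?thesis using Cauchy_Schwarz_ineq2[of x y] by linarith
  qed
  then show "AE \<omega> in M. norm (X \<omega> \<bullet> Y \<omega>) \<le> norm ((norm (X \<omega>))\<^sup>2 + (norm (Y \<omega>))\<^sup>2)"
    by (intro AE_I2) simp
qed

lemma square_integrable_bound:
  assumes "X \<in> borel_measurable M" "square_integrable M Y" "\<And>\<omega>. norm (X \<omega>) \<le> norm (Y \<omega>)"
  shows "square_integrable M X"
  unfolding square_integrable_def
proof
  show "integrable M (\<lambda>\<omega>. (norm (X \<omega>))\<^sup>2)"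
    by (rule Bochner_Integration.integrable_bound[where f = "\<lambda>\<omega>. (norm (Y \<omega>))\<^sup>2"])
      (use assms in \<open>auto simp: square_integrable_def intro!: power_mono\<close>)
qed fact

lemma square_integrable_scaleR [intro, simp]:
  "square_integrable M X \<Longrightarrow> square_integrable M (\<lambda>\<omega>. c *\<^sub>R X \<omega>)"
  by (auto simp: square_integrable_def power_mult_distrib)

lemma square_integrable_add [intro, simp]:
  assumes "square_integrable M X" "square_integrable M Y"
  shows "square_integrable M (\<lambda>\<omega>. X \<omega> + Y \<omega>)"
proof -
  have "(norm (X \<omega> + Y \<omega>))\<^sup>2 = (norm (X \<omega>))\<^sup>2 + (norm (Y \<omega>))\<^sup>2 + 2 * (X \<omega> \<bullet> Y \<omega>)" for \<omega>
    by (simp add: power2_norm_eq_inner inner_add_left inner_add_right inner_commute)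
  then show ?thesis
    using assms integrable_inner_square_integrable[OF assms] by (auto simp: square_integrable_def)
qed

lemma square_integrable_diff [intro, simp]:
  assumes "square_integrable M X" "square_integrable M Y"
  shows "square_integrable M (\<lambda>\<omega>. X \<omega> - Y \<omega>)"
  using square_integrable_add[OF assms(1) square_integrable_scaleR[OF assms(2), of "-1"]] by simp

lemma (in finite_measure) square_integrable_const [intro, simp]: "square_integrable M (\<lambda>\<omega>. c)"
  by (simp add: square_integrable_def)

lemma (in finite_measure) square_integrable_sum:
  "(\<And>i. i \<in> I \<Longrightarrow> square_integrable M (X i)) \<Longrightarrow> square_integrable M (\<lambda>\<omega>. \<Sum>i\<in>I. X i \<omega>)"
  by (induction I rule: infinite_finite_induct) auto

text \<open>\<open>F (X \<omega>) - F 0\<close> is dominated by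
  \<open>L * norm (X \<omega>)\<close>, and the constant \<open>F 0\<close> is square integrable on
  a finite measure space.\<close>

lemma (in finite_measure) square_integrable_lipschitz:
  fixes F :: "'b::euclidean_space \<Rightarrow> 'c::euclidean_space"
  assumes lip: "L-lipschitz_on UNIV F" and X: "square_integrable M X"
  shows "square_integrable M (\<lambda>\<omega>. F (X \<omega>))"
proof -
  have Fm[measurable]: "F \<in> borel_measurable borel"
    using lipschitz_on_continuous_on[OF lip] by (rule borel_measurable_continuous_onI)
  have [measurable]: "X \<in> borel_measurable M" using X by (rule square_integrable_measurable)
  have L: "0 \<le> L" using lip by (rule lipschitz_on_nonneg)
  have "square_integrable M (\<lambda>\<omega>. F (X \<omega>) - F 0)"
  proof -
    have "integrable M (\<lambda>\<omega>. (norm (F (X \<omega>) - F 0))\<^sup>2)"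
    proof (rule Bochner_Integration.integrable_bound)
      show "integrable M (\<lambda>\<omega>. L\<^sup>2 * (norm (X \<omega>))\<^sup>2)" using X by (simp add: square_integrable_def)
      have "(norm (F (X \<omega>) - F 0))\<^sup>2 \<le> (L * norm (X \<omega>))\<^sup>2" for \<omega>
        using lipschitz_onD[OF lip, of "X \<omega>" 0] by (intro power_mono) (auto simp: dist_norm)
      then show "AE \<omega> in M. norm ((norm (F (X \<omega>) - F 0))\<^sup>2) \<le> norm (L\<^sup>2 * (norm (X \<omega>))\<^sup>2)"
        by (intro AE_I2) (simp add: power_mult_distrib)
    qed measurable
    then show ?thesis by (simp add: square_integrable_def)
  qed
  then have "square_integrable M (\<lambda>\<omega>. (F (X \<omega>) - F 0) + F 0)" by (intro square_integrable_add) auto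
  then show ?thesis by simp
qed

section \<open>Calculus of the L2 inner product\<close>

lemma ip_commute: "ip M X Y = ip M Y X" by (simp add: ip_def inner_commute)

lemma ip_self_eq: "ip M X X = (\<integral>\<omega>. (norm (X \<omega>))\<^sup>2 \<partial>M)"
  by (simp add: ip_def power2_norm_eq_inner)

lemma ip_self_nonneg [simp]: "0 \<le> ip M X X" by (simp add: ip_self_eq)

lemma ip_scaleR_left: "ip M (\<lambda>\<omega>. c *\<^sub>R X \<omega>) Y = c * ip M X Y"
  and ip_scaleR_right: "ip M Y (\<lambda>\<omega>. c *\<^sub>R X \<omega>) = c * ip M Y X"
  by (simp_all add: ip_def)

lemma
  assumes "square_integrable M X" "square_integrable M Y" "square_integrable M Z"
  shows ip_add_left: "ip M (\<lambda>\<omega>. X \<omega> + Y \<omega>) Z = ip M X Z + ip M Y Z"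
    and ip_add_right: "ip M Z (\<lambda>\<omega>. X \<omega> + Y \<omega>) = ip M Z X + ip M Z Y"
    and ip_diff_left: "ip M (\<lambda>\<omega>. X \<omega> - Y \<omega>) Z = ip M X Z - ip M Y Z"
    and ip_diff_right: "ip M Z (\<lambda>\<omega>. X \<omega> - Y \<omega>) = ip M Z X - ip M Z Y"
  using assms by (simp_all add: ip_def inner_add_left inner_add_right inner_diff_left
      inner_diff_right integrable_inner_square_integrable)

lemma (in finite_measure) ip_sum_left:
  assumes "\<And>i. i \<in> I \<Longrightarrow> square_integrable M (X i)" "square_integrable M Y"
  shows "ip M (\<lambda>\<omega>. \<Sum>i\<in>I. X i \<omega>) Y = (\<Sum>i\<in>I. ip M (X i) Y)"
  using assms by (simp add: ip_def inner_sum_left integrable_inner_square_integrable)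

lemmas ip_simps = ip_add_left ip_add_right ip_diff_left ip_diff_right ip_scaleR_left ip_scaleR_right

lemma ip_self_add_scaleR:
  assumes "square_integrable M X" "square_integrable M Y"
  shows "ip M (\<lambda>\<omega>. X \<omega> + c *\<^sub>R Y \<omega>) (\<lambda>\<omega>. X \<omega> + c *\<^sub>R Y \<omega>) =
    ip M X X + 2 * c * ip M X Y + c\<^sup>2 * ip M Y Y"
  using assms by (simp add: ip_simps ip_commute[of M Y X]) (simp add: power2_eq_square algebra_simps)

lemma ip_self_mono:
  assumes "square_integrable M X" "square_integrable M Y" "\<And>\<omega>. norm (X \<omega>) \<le> c * norm (Y \<omega>)"
  shows "ip M X X \<le> c\<^sup>2 * ip M Y Y"
proof -
  have "(norm (X \<omega>))\<^sup>2 \<le> c\<^sup>2 * (norm (Y \<omega>))\<^sup>2" for \<omega>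
    using power_mono[OF assms(3)[of \<omega>] norm_ge_zero, of 2] by (simp add: power_mult_distrib)
  then have "(\<integral>\<omega>. (norm (X \<omega>))\<^sup>2 \<partial>M) \<le> (\<integral>\<omega>. c\<^sup>2 * (norm (Y \<omega>))\<^sup>2 \<partial>M)"
    using assms by (intro integral_mono) (auto simp: square_integrable_def)
  then show ?thesis by (simp add: ip_self_eq)
qed

text \<open>Pointwise Cauchy-Schwarz. It is meant for \<open>Y\<close> a noise and \<open>X\<close>
  the change of \<open>F\<close> caused by it, so that the loss is proportional to the
  variance.\<close>

lemma ip_lower_bound:
  assumes "square_integrable M X" "square_integrable M Y" "\<And>\<omega>. norm (X \<omega>) \<le> c * norm (Y \<omega>)"
  shows "- c * ip M Y Y \<le> ip M X Y"
proof -
  have "- c * (Y \<omega> \<bullet> Y \<omega>) \<le> X \<omega> \<bullet> Y \<omega>" for \<omega>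
  proof -
    have "\<bar>X \<omega> \<bullet> Y \<omega>\<bar> \<le> norm (X \<omega>) * norm (Y \<omega>)" by (rule Cauchy_Schwarz_ineq2)
    also have "\<dots> \<le> c * norm (Y \<omega>) * norm (Y \<omega>)" using assms(3) by (intro mult_right_mono) auto
    finally show ?thesis by (simp add: power2_norm_eq_inner[symmetric] power2_eq_square)
  qed
  then have "(\<integral>\<omega>. - c * (Y \<omega> \<bullet> Y \<omega>) \<partial>M) \<le> (\<integral>\<omega>. X \<omega> \<bullet> Y \<omega> \<partial>M)"
    using assms by (intro integral_mono integrable_mult_right integrable_inner_square_integrable) auto
  then show ?thesis by (simp add: ip_def)
qed

section \<open>The scalar recursion\<close>

text \<open>The weight \<open>\<kappa>\<close> solves
  \<open>(1 + \<kappa>) * \<theta> = \<kappa>\<close>, so \<open>V k / (a * \<gamma>)\<close> plus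
  \<open>a * \<kappa>\<close> times an increment is a Lyapunov function. Each
  \<open>\<phi> k\<close> collects \<open>\<rho> - a * (1 - \<gamma>)\<close> from its own step,
  \<open>a * \<kappa> * \<gamma>\<close> from the increment and \<open>- a\<close> from the next
  step; by \<open>slack\<close> the total is at most
  \<open>- ((a - \<rho>) + a * c * (1 - c))\<close>.\<close>

lemma ogda_summation:
  fixes V \<phi> \<delta> :: "nat \<Rightarrow> real" and a \<gamma> \<rho> c \<theta> s :: real
  defines "\<kappa> \<equiv> \<theta> / (1 - \<theta>)"
  assumes a: "0 < a" and \<gamma>: "0 < \<gamma>" and \<theta>: "0 \<le> \<theta>" "\<theta> < 1"
    and slack: "c * (1 - c) + \<kappa> * \<gamma> \<le> 1 - \<gamma>"
    and \<phi>: "\<And>k. 0 \<le> \<phi> k" and s: "0 \<le> s"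
    and energy: "\<And>k. V (Suc k) \<le> V k +
      a * \<gamma> * (\<rho> * \<phi> k + a * (\<delta> k - (1 - \<gamma>) * \<phi> k - \<phi> (k - 1) + 2 * s))"
    and increment: "\<And>k. \<delta> (Suc k) \<le> \<theta> * (\<gamma> * \<phi> k + \<delta> k) + 7 * c\<^sup>2 * s" "\<delta> 0 = 0"
    and boundary: "\<And>k. \<phi> k \<le> V (Suc k) / (a\<^sup>2 * \<gamma>) + \<kappa> * \<delta> k + 4 * s / \<gamma>"
  shows "((a - \<rho>) + a * c * (1 - c)) * (\<Sum>k\<le>m. \<phi> k) \<le>
    V 0 / (a * \<gamma>) + a * s * (real (Suc m) * (2 + 7 * c\<^sup>2 / (1 - \<theta>)) + 4 / \<gamma>)"
proof -
  define R where "R = (a - \<rho>) + a * c * (1 - c)"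
  define N where "N = 7 * c\<^sup>2 / (1 - \<theta>)"
  have \<kappa>: "0 \<le> \<kappa>" using \<theta> by (simp add: \<kappa>_def)
  have energy': "V (Suc k) / (a * \<gamma>) \<le>
      V k / (a * \<gamma>) + (\<rho> * \<phi> k + a * (\<delta> k - (1 - \<gamma>) * \<phi> k - \<phi> (k - 1) + 2 * s))" for k
    using energy[of k] a \<gamma> by (simp add: field_simps)
  have slack': "a * (c * (1 - c) + \<kappa> * \<gamma>) * \<phi> k \<le> a * (1 - \<gamma>) * \<phi> k" for k
    using slack a \<phi>[of k] by (intro mult_right_mono mult_left_mono) auto
  \<comment> \<open>The two trailing terms correct for contributions to \<open>\<phi> m\<close> that
    arrive only with step \<open>Suc m\<close>: the gain \<open>a * \<phi> m\<close> and the loss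
    \<open>a * \<kappa> * \<gamma> * \<phi> m\<close>.\<close>
  have pot: "V (Suc m) / (a * \<gamma>) + a * \<kappa> * \<delta> m + R * (\<Sum>k\<le>m. \<phi> k) - a * \<phi> m + a * \<kappa> * \<gamma> * \<phi> m
      \<le> V 0 / (a * \<gamma>) + a * s * (real (Suc m) * (2 + N))"
  proof (induction m)
    case 0
    \<comment> \<open>For \<open>k = 0\<close> truncated subtraction turns
      \<open>\<phi> (k - 1)\<close> into \<open>\<phi> 0\<close>; this extra negative term is
      discarded.\<close>
    have "0 \<le> a * \<phi> 0" "0 \<le> a * \<gamma> * \<phi> 0" "0 \<le> a * s * N"
      using a \<gamma> \<phi>[of 0] \<theta> s by (auto simp: N_def)
    then show ?case
      using energy'[of 0] slack'[of 0] increment(2) by (simp add: R_def algebra_simps)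
  next
    case (Suc m)
    have "(1 + \<kappa>) * \<delta> (Suc m) \<le> (1 + \<kappa>) * (\<theta> * (\<gamma> * \<phi> m + \<delta> m) + 7 * c\<^sup>2 * s)"
      using increment(1)[of m] \<kappa> by (intro mult_left_mono) auto
    also have "(1 + \<kappa>) = 1 / (1 - \<theta>)" using \<theta> by (simp add: \<kappa>_def field_simps)
    also have "1 / (1 - \<theta>) * (\<theta> * (\<gamma> * \<phi> m + \<delta> m) + 7 * c\<^sup>2 * s)
        = \<kappa> * (\<gamma> * \<phi> m + \<delta> m) + s * N"
      by (simp add: \<kappa>_def N_def add_divide_distrib mult.commute)
    finally have "a * (\<delta> (Suc m) / (1 - \<theta>)) \<le>
        a * (\<kappa> * (\<gamma> * \<phi> m + \<delta> m) + s * N)"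
      using a by (intro mult_left_mono) auto
    moreover have "a * (\<delta> (Suc m) / (1 - \<theta>)) = a * \<delta> (Suc m) + a * \<kappa> * \<delta> (Suc m)"
      using \<theta> by (simp add: \<kappa>_def field_simps)
    ultimately show ?case
      using Suc.IH energy'[of "Suc m"] slack'[of "Suc m"] by (simp add: R_def algebra_simps)
  qed
  \<comment> \<open>After multiplication by \<open>a\<close>, the \<open>V\<close> and
    \<open>\<delta>\<close> terms of \<open>boundary\<close> are exactly those kept in
    \<open>pot\<close>. They pay for \<open>- a * \<phi> m\<close>, leaving only the noise term with
    \<open>4 / \<gamma>\<close>.\<close>
  have "a * \<phi> m \<le> a * (V (Suc m) / (a\<^sup>2 * \<gamma>) + \<kappa> * \<delta> m + 4 * s / \<gamma>)"
    using boundary a by (intro mult_left_mono) auto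
  also have "\<dots> = V (Suc m) / (a * \<gamma>) + a * \<kappa> * \<delta> m + a * s * (4 / \<gamma>)"
    using a \<gamma> by (simp add: field_simps power2_eq_square)
  finally have "R * (\<Sum>k\<le>m. \<phi> k) + a * \<kappa> * \<gamma> * \<phi> m \<le>
      V 0 / (a * \<gamma>) + a * s * (real (Suc m) * (2 + N)) + a * s * (4 / \<gamma>)"
    using pot by linarith
  moreover have "0 \<le> a * \<kappa> * \<gamma> * \<phi> m" using a \<kappa> \<gamma> \<phi> by simp
  ultimately show ?thesis unfolding N_def[symmetric] by (simp add: R_def algebra_simps)
qed

text \<open>Here \<open>c\<close> is \<open>a * L\<close>, and its bound is the step size condition.
  Split \<open>1 - \<gamma>\<close> into \<open>(1 - \<gamma>) * (1 - c)\<close>, which dominates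
  \<open>c * (1 - c)\<close>, and \<open>(1 - \<gamma>) * c\<close>, which dominates the term with
  \<open>\<theta> / (1 - \<theta>)\<close>.\<close>

lemma ogda_slack:
  fixes c \<gamma> :: real
  defines "\<theta> \<equiv> c\<^sup>2 * (1 + \<gamma>)"
  assumes c: "0 < c" "c * (1 + \<gamma>) < 1 - \<gamma>" and \<gamma>: "0 < \<gamma>"
  shows "0 < \<theta>" "\<theta> \<le> c" "\<theta> \<le> 1 - \<gamma>" "\<theta> < 1" "c < 1 - \<gamma>"
    "c * (1 - c) + \<theta> / (1 - \<theta>) * \<gamma> \<le> 1 - \<gamma>"
proof -
  show 0: "0 < \<theta>" using c \<gamma> by (simp add: \<theta>_def)
  have 1: "\<theta> \<le> c * (1 - \<gamma>)"
    using mult_left_mono[of "c * (1 + \<gamma>)" "1 - \<gamma>" c] c by (simp add: \<theta>_def power2_eq_square mult_ac)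
  have cg: "0 < c * \<gamma>" using c \<gamma> by simp
  show c1: "c < 1 - \<gamma>" using c cg by (simp add: algebra_simps)
  show 2: "\<theta> \<le> c" using 1 cg by (simp add: algebra_simps)
  show "\<theta> \<le> 1 - \<gamma>" "\<theta> < 1" using 2 c1 \<gamma> by linarith+
  \<comment> \<open>The upper bound for \<open>\<theta>\<close> found above. It satisfies
    \<open>\<gamma> \<le> 1 - t\<close>, which cancels the denominator \<open>1 - t\<close>.\<close>
  define t where "t = c * (1 - \<gamma>)"
  have t1: "t < 1" using c1 cg \<gamma> by (simp add: t_def algebra_simps)
  have "\<theta> / (1 - \<theta>) \<le> t / (1 - t)"
    using 0 1 t1 by (intro frac_le) (auto simp: t_def)
  then have "\<theta> / (1 - \<theta>) * \<gamma> \<le> t / (1 - t) * \<gamma>" using \<gamma> by (intro mult_right_mono) auto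
  moreover have "c * (1 - c) \<le> (1 - \<gamma>) * (1 - c)" using c1 \<gamma> by (intro mult_right_mono) auto
  moreover have "(1 - \<gamma>) * (1 - c) + t / (1 - t) * \<gamma> \<le> 1 - \<gamma>"
  proof -
    have "t * \<gamma> \<le> (1 - \<gamma>) * c * (1 - t)"
    proof -
      have "c * (1 - \<gamma>) \<le> 1 * (1 - \<gamma>)" using c1 c \<gamma> by (intro mult_right_mono) linarith+
      then have "\<gamma> \<le> 1 - t" by (simp add: t_def)
      then have "t * \<gamma> \<le> t * (1 - t)" using c1 c by (intro mult_left_mono) (auto simp: t_def)
      then show ?thesis by (simp add: t_def mult_ac)
    qed
    then have "t / (1 - t) * \<gamma> \<le> (1 - \<gamma>) * c" using t1 by (simp add: field_simps)
    then show ?thesis by (simp add: algebra_simps)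
  qed
  ultimately show "c * (1 - c) + \<theta> / (1 - \<theta>) * \<gamma> \<le> 1 - \<gamma>" by linarith
qed

text \<open>With \<open>\<alpha> = \<gamma> * \<theta> / (1 - \<theta>)\<close> the left side is
  \<open>\<gamma> * (2 + 1 / \<alpha>)\<close>, where the bracket is the loss factor of
  \<open>norm_add3_sq_le\<close>; the right side is the coefficient of \<open>\<phi> k\<close> in
  the lower estimate of \<open>boundary\<close>, up to \<open>a\<^sup>2\<close>. Clearing
  denominators leaves a polynomial inequality in \<open>\<gamma>\<close> and
  \<open>\<theta>\<close>.\<close>

lemma ogda_boundary_weight:
  fixes c \<gamma> :: real
  defines "\<theta> \<equiv> c\<^sup>2 * (1 + \<gamma>)"
  assumes c: "0 < c" "c * (1 + \<gamma>) < 1 - \<gamma>" and \<gamma>: "0 < \<gamma>"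
  shows "\<gamma> * (2 + (1 - \<theta>) / (\<gamma> * \<theta>)) \<le> 1 / c\<^sup>2 - \<gamma> * (1 - \<gamma>)"
proof -
  have \<theta>: "0 < \<theta>" "\<theta> \<le> 1 - \<gamma>" using ogda_slack[OF c \<gamma>] by (simp_all add: \<theta>_def)
  have "0 \<le> \<gamma> + \<theta> - \<gamma> * \<theta> * (3 - \<gamma>)"
  proof -
    have "\<gamma> * \<theta> * (1 - \<gamma>) \<le> \<theta> * (1 - \<gamma>)"
      using \<theta> \<gamma> by (intro mult_right_mono mult_left_le_one_le) auto
    moreover have "0 \<le> \<gamma> * (1 - 2 * \<theta>) + \<theta> * \<gamma>"
    proof -
      have "\<theta> \<le> 1" using \<theta> \<gamma> by simp
      then have "0 \<le> \<gamma> * (1 - \<theta>)" using \<gamma> by simp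
      then show ?thesis by (simp add: algebra_simps)
    qed
    ultimately show ?thesis by (simp add: algebra_simps)
  qed
  then have "0 \<le> \<gamma> * (\<gamma> + \<theta> - \<gamma> * \<theta> * (3 - \<gamma>))" using \<gamma> by simp
  moreover have "1 / c\<^sup>2 = (1 + \<gamma>) / \<theta>" using c \<gamma> by (simp add: \<theta>_def)
  ultimately show ?thesis using \<theta>(1) \<gamma> by (simp add: field_simps)
qed

text \<open>If every \<open>\<phi> k\<close> exceeded \<open>\<epsilon>\<close>, the part
  \<open>a * (a * L) * (1 - a * L)\<close> of the coefficient would absorb the noise, and the part
  \<open>a - \<rho>\<close> would bound \<open>Suc m\<close> strictly below its assumed
  size.\<close>

lemma ogda_stopping:
  fixes \<phi> :: "nat \<Rightarrow> real" and V0 a L \<gamma> \<rho> s \<theta> q \<epsilon> :: real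
  assumes bound: "((a - \<rho>) + a * (a * L) * (1 - a * L)) * (\<Sum>k\<le>m. \<phi> k) \<le>
      V0 / (a * \<gamma>) + a * s * (real (Suc m) * (2 + 7 * (a * L)\<^sup>2 / (1 - \<theta>)) + 4 / \<gamma>)"
    and V0: "\<phi> 0 * (1 / L\<^sup>2) \<le> V0"
    and a: "0 < \<rho>" "\<rho> < a" and L: "0 < L" and \<gamma>: "0 < \<gamma>"
    and q: "a * L \<le> q" "q < 1" and \<theta>: "\<theta> \<le> a * L" and \<epsilon>: "0 < \<epsilon>"
    and s: "0 \<le> s" "s \<le> (1 - q)\<^sup>2 * (a * L) * \<epsilon> / 13"
    and m: "V0 / (\<epsilon> * a * \<gamma> * (a - \<rho>)) \<le> real (Suc m)"
  shows "\<exists>i\<le>m. \<phi> i \<le> \<epsilon>"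
proof (rule ccontr)
  assume "\<not> (\<exists>i\<le>m. \<phi> i \<le> \<epsilon>)"
  then have large: "\<epsilon> < \<phi> i" if "i \<le> m" for i
    using that by (meson not_le)
  define c where "c = a * L"
  define K where "K = real (Suc m)"
  have a0: "0 < a" using a by simp
  have c: "0 < c" "c \<le> q" "c < 1" using a0 L q by (simp_all add: c_def)
  have K: "0 < K" by (simp add: K_def)
  have "K * \<epsilon> = (\<Sum>k\<le>m. \<epsilon>)" by (simp add: K_def)
  also have "\<dots> < (\<Sum>k\<le>m. \<phi> k)" using large by (intro sum_strict_mono) auto
  finally have S: "K * \<epsilon> < (\<Sum>k\<le>m. \<phi> k)" .
  have R: "0 < (a - \<rho>) + a * c * (1 - c)" using a a0 c by (intro add_pos_nonneg) auto
  \<comment> \<open>The noise term \<open>4 / \<gamma>\<close> carries no factor \<open>K\<close>.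
    It is covered because \<open>\<phi> 0 > \<epsilon>\<close> forces \<open>V0\<close> to be at
    least \<open>\<epsilon> / L\<^sup>2\<close>, while
    \<open>L\<^sup>2 * (a * (a - \<rho>)) \<le> 1\<close>.\<close>
  have \<gamma>K: "1 / \<gamma> \<le> K"
  proof -
    have "\<epsilon> * (1 / L\<^sup>2) \<le> \<phi> 0 * (1 / L\<^sup>2)" using large[of 0] L by (intro mult_right_mono) auto
    then have "\<epsilon> / L\<^sup>2 \<le> V0" using V0 by simp
    then have "\<epsilon> / L\<^sup>2 / (\<epsilon> * a * \<gamma> * (a - \<rho>)) \<le> V0 / (\<epsilon> * a * \<gamma> * (a - \<rho>))"
      using \<epsilon> a a0 \<gamma> by (intro divide_right_mono) auto
    also have "\<dots> \<le> K" using m by (simp add: K_def)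
    finally have 1: "1 / (L\<^sup>2 * (a * (a - \<rho>)) * \<gamma>) \<le> K" using \<epsilon> by (simp add: mult_ac)
    have "L\<^sup>2 * (a * (a - \<rho>)) \<le> L\<^sup>2 * (a * a)" using a a0 by (intro mult_left_mono) auto
    also have "\<dots> = c\<^sup>2" by (simp add: c_def power2_eq_square mult_ac)
    also have "\<dots> \<le> 1" using c by (simp add: power_le_one)
    finally have "L\<^sup>2 * (a * (a - \<rho>)) * \<gamma> \<le> \<gamma>" using \<gamma> by simp
    then have "1 / \<gamma> \<le> 1 / (L\<^sup>2 * (a * (a - \<rho>)) * \<gamma>)"
      using L a a0 \<gamma> by (intro divide_left_mono) auto
    then show ?thesis using 1 by simp
  qed
  \<comment> \<open>The 13 is \<open>2 + 7 + 4\<close>, with \<open>1 / (1 - q)\<close> bounding the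
    denominator. Of the two factors \<open>1 - q\<close> in the bound on \<open>s\<close>, one
    cancels this quotient and the other is at most \<open>1 - c\<close>.\<close>
  have noise: "s * (K * (2 + 7 * c\<^sup>2 / (1 - \<theta>)) + 4 / \<gamma>) \<le> c * (1 - c) * \<epsilon> * K"
  proof -
    have q1: "0 < 1 - q" "1 - q \<le> 1" using q c by auto
    have "7 * c\<^sup>2 / (1 - \<theta>) \<le> 7 * 1 / (1 - q)"
      using c q1 \<theta> by (intro frac_le) (auto simp: power_le_one c_def)
    moreover have "2 \<le> 2 / (1 - q)" "4 \<le> 4 / (1 - q)" using q1 by (simp_all add: field_simps)
    moreover have "2 / (1 - q) + 7 * 1 / (1 - q) + 4 / (1 - q) = 13 / (1 - q)"
      by (simp add: add_divide_distrib[symmetric])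
    ultimately have "2 + 7 * c\<^sup>2 / (1 - \<theta>) + 4 \<le> 13 / (1 - q)" by linarith
    then have "K * (2 + 7 * c\<^sup>2 / (1 - \<theta>) + 4) \<le> K * (13 / (1 - q))"
      using K by (intro mult_left_mono) auto
    then have "K * (2 + 7 * c\<^sup>2 / (1 - \<theta>)) + 4 / \<gamma> \<le> K * (13 / (1 - q))"
      using \<gamma>K by (simp add: distrib_left)
    then have "s * (K * (2 + 7 * c\<^sup>2 / (1 - \<theta>)) + 4 / \<gamma>) \<le> s * (K * (13 / (1 - q)))"
      using s by (intro mult_left_mono) auto
    also have "\<dots> \<le> (1 - q)\<^sup>2 * c * \<epsilon> / 13 * (K * (13 / (1 - q)))"
      using s K q1 by (intro mult_right_mono) (auto simp: c_def)
    also have "\<dots> = c * (1 - q) * \<epsilon> * K" using q1 by (simp add: power2_eq_square)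
    also have "\<dots> \<le> c * (1 - c) * \<epsilon> * K"
      using c \<epsilon> K by (intro mult_right_mono mult_left_mono) auto
    finally show ?thesis .
  qed
  have "((a - \<rho>) + a * c * (1 - c)) * (K * \<epsilon>) < ((a - \<rho>) + a * c * (1 - c)) * (\<Sum>k\<le>m. \<phi> k)"
    using S R by (rule mult_strict_left_mono)
  also have "\<dots> \<le> V0 / (a * \<gamma>) + a * (s * (K * (2 + 7 * c\<^sup>2 / (1 - \<theta>)) + 4 / \<gamma>))"
    using bound by (simp add: c_def K_def mult_ac)
  also have "\<dots> \<le> V0 / (a * \<gamma>) + a * (c * (1 - c) * \<epsilon> * K)"
    using noise a0 by (intro add_left_mono mult_left_mono) auto
  finally have "(a - \<rho>) * (K * \<epsilon>) < V0 / (a * \<gamma>)" by (simp add: algebra_simps)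
  then have "K < V0 / (\<epsilon> * a * \<gamma> * (a - \<rho>))" using a a0 \<epsilon> \<gamma> by (simp add: field_simps)
  then show False using m by (simp add: K_def)
qed

section \<open>Energy estimates in the presence of noise\<close>

text \<open>The two sides differ by exactly \<open>t * (norm (x - y))\<^sup>2\<close>.\<close>

lemma norm_add_sq_le:
  fixes x y :: "'b::real_inner"
  assumes "0 \<le> t"
  shows "(norm (t *\<^sub>R x + y))\<^sup>2 \<le> (1 + t) * (t * (norm x)\<^sup>2 + (norm y)\<^sup>2)"
proof -
  have "0 \<le> t * (norm (x - y))\<^sup>2" using assms by simp
  then show ?thesis
    by (simp add: power2_norm_eq_inner inner_add_left inner_add_right inner_diff_left
        inner_diff_right inner_commute algebra_simps)
qed

text \<open>Cauchy-Schwarz with weights 1, \<open>1 / \<alpha>\<close> and 1. The two sides differ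
  by exactly the sum of squares in the first step.\<close>

lemma norm_add3_sq_le:
  fixes x y w :: "'b::real_inner"
  assumes "0 < \<alpha>"
  shows "(norm (x + y + w))\<^sup>2 \<le> (2 + 1 / \<alpha>) * ((norm x)\<^sup>2 + \<alpha> * (norm y)\<^sup>2 + (norm w)\<^sup>2)"
proof -
  have "0 \<le> (norm (x - \<alpha> *\<^sub>R y))\<^sup>2 / \<alpha> + (norm (w - \<alpha> *\<^sub>R y))\<^sup>2 / \<alpha> + (norm (x - w))\<^sup>2"
    using assms by simp
  moreover have sq: "(norm (v - \<alpha> *\<^sub>R y))\<^sup>2 / \<alpha> = v \<bullet> v / \<alpha> - 2 * (v \<bullet> y) + \<alpha> * (y \<bullet> y)" for v
    using assms
    by (simp add: power2_norm_eq_inner inner_diff_left inner_diff_right inner_commute[of y v] field_simps)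
  moreover have "(norm (x - w))\<^sup>2 = x \<bullet> x - 2 * (x \<bullet> w) + w \<bullet> w"
    by (simp add: power2_norm_eq_inner inner_diff_left inner_diff_right inner_commute[of w x])
  moreover have "(norm (x + y + w))\<^sup>2 =
      x \<bullet> x + y \<bullet> y + w \<bullet> w + 2 * (x \<bullet> y) + 2 * (w \<bullet> y) + 2 * (x \<bullet> w)"
    by (simp add: power2_norm_eq_inner inner_add_left inner_add_right inner_commute[of w x]
        inner_commute[of y x] inner_commute[of y w])
  moreover have "(2 + 1 / \<alpha>) * ((norm x)\<^sup>2 + \<alpha> * (norm y)\<^sup>2 + (norm w)\<^sup>2) =
      2 * (x \<bullet> x) + 2 * \<alpha> * (y \<bullet> y) + 2 * (w \<bullet> w) + x \<bullet> x / \<alpha> + y \<bullet> y + w \<bullet> w / \<alpha>"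
    using assms by (simp add: power2_norm_eq_inner distrib_left distrib_right)
  ultimately show ?thesis using sq[of x] sq[of w] by linarith
qed

text \<open>Randomness enters only through L2 orthogonality. \<open>n k\<close> is the noise of the
  k-th estimator, and \<open>fh k\<close> stands for \<open>F\<close> at the next iterate with this
  noise removed. The index \<open>k - 1\<close> at \<open>k = 0\<close> encodes the start
  \<open>u_{-1} = u_0\<close>, where the same noise \<open>n 0\<close> occurs twice.\<close>

locale noisy_ogda = prob_space M
  for M :: "'w measure" +
  fixes F :: "'a::euclidean_space \<Rightarrow> 'a" and L \<rho> a \<gamma> s :: real and ustar :: 'a
    and u n fh :: "nat \<Rightarrow> 'w \<Rightarrow> 'a"
  assumes lip: "L-lipschitz_on UNIV F"
    and minty: "weak_minty_solution F \<rho> ustar"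
    and L_\<rho>: "\<rho> < 1 / L"
    and \<gamma>: "0 < \<gamma>" "\<gamma> \<le> 1"
    and a: "\<rho> < a" "a < (1 - \<gamma>) / (1 + \<gamma>) * (1 / L)"
    and si_u: "\<And>k. square_integrable M (u k)"
    and si_n: "\<And>k. square_integrable M (n k)"
    and si_fh: "\<And>k. square_integrable M (fh k)"
    and u_Suc: "\<And>k \<omega>. u (Suc k) \<omega> = u k \<omega> -
      a *\<^sub>R ((1 + \<gamma>) *\<^sub>R (F (u k \<omega>) + n k \<omega>) - (F (u (k - 1) \<omega>) + n (k - 1) \<omega>))"
    and orth_u: "\<And>k. ip M (n k) (\<lambda>\<omega>. u k \<omega> - ustar) = 0"
    and orth_f: "\<And>k j. j \<le> k \<Longrightarrow> ip M (n k) (\<lambda>\<omega>. F (u j \<omega>)) = 0"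
    and orth_n: "\<And>k j. j < k \<Longrightarrow> ip M (n k) (n j) = 0"
    and orth_fh: "\<And>k. ip M (n k) (fh k) = 0"
    and fh: "\<And>k \<omega>. norm (F (u (Suc k) \<omega>) - fh k \<omega>) \<le> L * a * (1 + \<gamma>) * norm (n k \<omega>)"
    and var: "\<And>k. ip M (n k) (n k) \<le> s"
begin

definition f where "f k = (\<lambda>\<omega>. F (u k \<omega>))"
text \<open>By truncated subtraction \<open>z 0\<close> is \<open>u 0\<close> plus \<open>a\<close>
  times the first estimator, so \<open>V 0\<close> becomes the expectation in the final
  bound.\<close>

definition z where "z k = (\<lambda>\<omega>. u k \<omega> + a *\<^sub>R (f (k - 1) \<omega> + n (k - 1) \<omega>))"
definition \<phi> where "\<phi> k = ip M (f k) (f k)"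
definition \<delta> where "\<delta> k = ip M (\<lambda>\<omega>. f k \<omega> - f (k - 1) \<omega>) (\<lambda>\<omega>. f k \<omega> - f (k - 1) \<omega>)"
definition V where "V k = ip M (\<lambda>\<omega>. z k \<omega> - ustar) (\<lambda>\<omega>. z k \<omega> - ustar)"

lemma \<rho>_pos: "0 < \<rho>" and minty': "- (\<rho> / 2) * (norm (F x))\<^sup>2 \<le> F x \<bullet> (x - ustar)"
  using minty by (auto simp: weak_minty_solution_def)

lemma a_pos: "0 < a" using a(1) \<rho>_pos by simp

lemma L_pos: "0 < L"
  using L_\<rho> \<rho>_pos lipschitz_on_nonneg[OF lip] by (cases "L = 0") auto

lemma aL: "0 < a * L" "a * L * (1 + \<gamma>) < 1 - \<gamma>"
proof -
  show "0 < a * L" using a_pos L_pos by simp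
  have "a < (1 - \<gamma>) / ((1 + \<gamma>) * L)" using a(2) by simp
  then show "a * L * (1 + \<gamma>) < 1 - \<gamma>"
    using L_pos \<gamma> by (subst (asm) pos_less_divide_eq) (auto simp: mult_ac)
qed

lemma s_nonneg: "0 \<le> s" using var[of 0] ip_self_nonneg[of M "n 0"] by linarith

lemma si_f: "square_integrable M (f k)"
  unfolding f_def using lip si_u by (rule square_integrable_lipschitz)

lemmas si = si_u si_n si_fh si_f

lemma si_z: "square_integrable M (z k)"
  unfolding z_def by (intro square_integrable_add square_integrable_scaleR si)

lemma z_Suc: "z (Suc k) \<omega> = z k \<omega> - (a * \<gamma>) *\<^sub>R (f k \<omega> + n k \<omega>)"
  by (simp add: z_def u_Suc f_def algebra_simps)

lemma orth:
  "ip M (n k) (f k) = 0" "ip M (f k) (n k) = 0" "ip M (n k) (f (k - Suc 0)) = 0" "ip M (f (k - Suc 0)) (n k) = 0"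
  "0 < k \<Longrightarrow> ip M (n k) (n (k - Suc 0)) = 0"
  using orth_f[of k k] orth_f[of "k - 1" k] orth_n[of "k - 1" k] by (simp_all add: f_def ip_commute)

text \<open>The point \<open>u\<^sub>k\<close> depends on the noise \<open>n\<^sub>k\<^sub>-\<^sub>1\<close>. Comparing \<open>F u\<^sub>k\<close> with its value \<open>fh\<close> at the
  noise-free point costs only a multiple of the variance; a bare Young inequality would lose a
  further factor of order \<open>1 / (a L)\<close> in the batch size.\<close>

lemma ip_f_prev_noise:
  assumes "0 < k"
  shows "- (1 - \<gamma>) * s \<le> ip M (f k) (n (k - 1))"
proof -
  obtain j where k: "k = Suc j" using assms by (cases k) auto
  have "- (L * a * (1 + \<gamma>)) * ip M (n j) (n j) \<le> ip M (\<lambda>\<omega>. f k \<omega> - fh j \<omega>) (n j)"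
    by (rule ip_lower_bound) (use fh in \<open>auto simp: k f_def[symmetric] si\<close>, simp add: f_def)
  also have "\<dots> = ip M (f k) (n j)"
    using orth_fh[of j] by (simp add: ip_simps si ip_commute)
  finally have 1: "- (L * a * (1 + \<gamma>)) * ip M (n j) (n j) \<le> ip M (f k) (n j)" .
  have "(L * a * (1 + \<gamma>)) * ip M (n j) (n j) \<le> (1 - \<gamma>) * s"
    using aL var[of j] \<gamma> by (intro mult_mono) (auto simp: mult_ac)
  then show ?thesis using 1 by (simp add: k algebra_simps)
qed

lemma ip_f_minty: "- (\<rho> / 2) * \<phi> k \<le> ip M (f k) (\<lambda>\<omega>. u k \<omega> - ustar)"
proof -
  have "(\<integral>\<omega>. - (\<rho> / 2) * (f k \<omega> \<bullet> f k \<omega>) \<partial>M) \<le> (\<integral>\<omega>. f k \<omega> \<bullet> (u k \<omega> - ustar) \<partial>M)"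
  proof (intro integral_mono integrable_mult_right integrable_inner_square_integrable)
    show "- (\<rho> / 2) * (f k \<omega> \<bullet> f k \<omega>) \<le> f k \<omega> \<bullet> (u k \<omega> - ustar)" for \<omega>
      using minty'[of "u k \<omega>"] by (simp add: f_def power2_norm_eq_inner)
  qed (auto simp: si)
  then show ?thesis by (simp add: \<phi>_def ip_def)
qed

text \<open>In the expanded square, Minty controls \<open>f k\<close> against
  \<open>u k - ustar\<close>, and polarization turns the product of \<open>f k\<close> with
  \<open>f (k - 1)\<close> into \<open>\<phi>\<close> and \<open>\<delta>\<close>. Orthogonality
  removes all noise products except the variance and the correlations with the previous
  noise.\<close>

lemma energy:
  "V (Suc k) \<le> V k +
    a * \<gamma> * (\<rho> * \<phi> k + a * (\<delta> k - (1 - \<gamma>) * \<phi> k - \<phi> (k - 1) + 2 * s))"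
proof -
  let ?w = "\<lambda>\<omega>. u k \<omega> - ustar" and ?X = "\<lambda>\<omega>. z k \<omega> - ustar" and ?G = "\<lambda>\<omega>. f k \<omega> + n k \<omega>"
  let ?f = "f k" and ?f' = "f (k - 1)" and ?n = "n k" and ?n' = "n (k - 1)"
  have si': "square_integrable M ?w" "square_integrable M ?X" "square_integrable M ?G"
    by (auto simp: si si_z)
  have "V (Suc k) = ip M (\<lambda>\<omega>. ?X \<omega> + (- (a * \<gamma>)) *\<^sub>R ?G \<omega>) (\<lambda>\<omega>. ?X \<omega> + (- (a * \<gamma>)) *\<^sub>R ?G \<omega>)"
    by (simp add: V_def z_Suc algebra_simps)
  also have "\<dots> = V k - 2 * (a * \<gamma>) * ip M ?G ?X + (a * \<gamma>)\<^sup>2 * ip M ?G ?G"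
    by (subst ip_self_add_scaleR[OF si'(2,3)]) (simp add: V_def ip_commute[of M ?X ?G])
  also have "ip M ?G ?G = \<phi> k + ip M ?n ?n"
    by (simp add: ip_simps si orth \<phi>_def)
  also have "ip M ?G ?X = ip M ?f ?w + a * (ip M ?f ?f' + (ip M ?f ?n' + ip M ?n ?n'))"
  proof -
    have "?X = (\<lambda>\<omega>. ?w \<omega> + a *\<^sub>R (?f' \<omega> + ?n' \<omega>))" by (simp add: z_def algebra_simps)
    then have "ip M ?G ?X = ip M ?G (\<lambda>\<omega>. ?w \<omega> + a *\<^sub>R (?f' \<omega> + ?n' \<omega>))" by simp
    also have "\<dots> = ip M ?G ?w + a * ip M ?G (\<lambda>\<omega>. ?f' \<omega> + ?n' \<omega>)"
      using si' by (subst ip_add_right) (auto simp: si ip_scaleR_right)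
    also have "ip M ?G ?w = ip M ?f ?w"
      using si' orth_u[of k] by (subst ip_add_left) (auto simp: si)
    also have "ip M ?G (\<lambda>\<omega>. ?f' \<omega> + ?n' \<omega>) = ip M ?f ?f' + (ip M ?f ?n' + ip M ?n ?n')"
      by (simp add: ip_simps si orth)
    finally show ?thesis .
  qed
  also have "ip M ?f ?f' = (\<phi> k + \<phi> (k - 1) - \<delta> k) / 2"
    by (simp add: \<delta>_def \<phi>_def ip_simps si ip_commute[of M "f (k - Suc 0)" "f k"])
  finally have V: "V (Suc k) = V k - 2 * (a * \<gamma>) * (ip M ?f ?w + a * ((\<phi> k + \<phi> (k - 1) - \<delta> k) / 2
      + (ip M ?f ?n' + ip M ?n ?n'))) + (a * \<gamma>)\<^sup>2 * (\<phi> k + ip M ?n ?n)" .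
  \<comment> \<open>For \<open>k = 0\<close> both noises coincide, so their product is a nonnegative
    variance, which enters \<open>V (Suc k)\<close> with a negative sign. For \<open>k > 0\<close>
    it vanishes.\<close>
  have cross: "- (1 - \<gamma>) * s \<le> ip M ?f ?n' + ip M ?n ?n'"
  proof (cases "k = 0")
    case True
    have "0 \<le> (1 - \<gamma>) * s" using \<gamma> s_nonneg by simp
    moreover have "0 \<le> ip M (n 0) (n 0)" by simp
    ultimately show ?thesis using True orth(2)[of 0] by (simp only: diff_0_eq_0)
  next
    case False
    then show ?thesis using ip_f_prev_noise[of k] orth(5)[of k] by simp
  qed
  have 1: "- (2 * (a * \<gamma>)) * ip M ?f ?w \<le> - (2 * (a * \<gamma>)) * (- (\<rho> / 2) * \<phi> k)"
    using ip_f_minty[of k] a_pos \<gamma> by (intro mult_left_mono_neg) auto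
  have 2: "- (2 * a\<^sup>2 * \<gamma>) * (ip M ?f ?n' + ip M ?n ?n') \<le> - (2 * a\<^sup>2 * \<gamma>) * (- (1 - \<gamma>) * s)"
    using cross \<gamma> by (intro mult_left_mono_neg) auto
  have 3: "(a * \<gamma>)\<^sup>2 * ip M ?n ?n \<le> (a * \<gamma>)\<^sup>2 * s" using var by (intro mult_left_mono) auto
  have "V (Suc k) \<le> V k + a * \<gamma> * \<rho> * \<phi> k - a\<^sup>2 * \<gamma> * (\<phi> k + \<phi> (k - 1) - \<delta> k)
      + 2 * a\<^sup>2 * \<gamma> * (1 - \<gamma>) * s + (a * \<gamma>)\<^sup>2 * \<phi> k + (a * \<gamma>)\<^sup>2 * s"
  proof -
    have "V (Suc k) = V k + - (2 * (a * \<gamma>)) * ip M ?f ?w - a\<^sup>2 * \<gamma> * (\<phi> k + \<phi> (k - 1) - \<delta> k)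
        + - (2 * a\<^sup>2 * \<gamma>) * (ip M ?f ?n' + ip M ?n ?n') + (a * \<gamma>)\<^sup>2 * \<phi> k + (a * \<gamma>)\<^sup>2 * ip M ?n ?n"
      unfolding V by algebra
    moreover have "- (2 * (a * \<gamma>)) * (- (\<rho> / 2) * \<phi> k) = a * \<gamma> * \<rho> * \<phi> k"
      "- (2 * a\<^sup>2 * \<gamma>) * (- (1 - \<gamma>) * s) = 2 * a\<^sup>2 * \<gamma> * (1 - \<gamma>) * s" by (algebra, algebra)
    ultimately show ?thesis using 1 2 3 by linarith
  qed
  \<comment> \<open>The noise coefficients combine because
    \<open>2 * (1 - \<gamma>) + \<gamma> \<le> 2\<close>.\<close>
  also have "\<dots> \<le> V k + a * \<gamma> * (\<rho> * \<phi> k + a * (\<delta> k - (1 - \<gamma>) * \<phi> k - \<phi> (k - 1) + 2 * s))"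
  proof -
    have "0 \<le> (a * \<gamma>)\<^sup>2 * s" using s_nonneg by simp
    then show ?thesis by (simp add: power2_eq_square algebra_simps)
  qed
  finally show ?thesis .
qed

text \<open>By the Lipschitz condition it suffices to estimate the update direction. Its noise-free
  part is read as \<open>\<gamma>\<close> times \<open>f k\<close> plus the increment of
  \<open>f\<close>, so that \<open>norm_add_sq_le\<close> produces the factor
  \<open>1 + \<gamma>\<close>.\<close>

lemma increment:
  "\<delta> (Suc k) \<le> (a * L)\<^sup>2 * (1 + \<gamma>) * (\<gamma> * \<phi> k + \<delta> k) + 7 * (a * L)\<^sup>2 * s"
proof -
  let ?f = "f k" and ?f' = "f (k - 1)" and ?n = "n k" and ?n' = "n (k - 1)"
  let ?Q = "\<lambda>\<omega>. (1 + \<gamma>) *\<^sub>R (?f \<omega> + ?n \<omega>) - (?f' \<omega> + ?n' \<omega>)"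
  let ?R = "\<lambda>\<omega>. (1 + \<gamma>) *\<^sub>R ?f \<omega> - ?f' \<omega>"
  have "\<delta> (Suc k) \<le> (a * L)\<^sup>2 * ip M ?Q ?Q"
    unfolding \<delta>_def diff_Suc_1
  proof (rule ip_self_mono)
    show "norm (f (Suc k) \<omega> - f k \<omega>) \<le> a * L * norm (?Q \<omega>)" for \<omega>
    proof -
      have "norm (f (Suc k) \<omega> - f k \<omega>) \<le> L * norm (u (Suc k) \<omega> - u k \<omega>)"
        using lipschitz_onD[OF lip, of "u (Suc k) \<omega>" "u k \<omega>"] by (simp add: f_def dist_norm)
      also have "u (Suc k) \<omega> - u k \<omega> = - (a *\<^sub>R ?Q \<omega>)" by (simp add: u_Suc f_def)
      finally show ?thesis using a_pos by (simp add: mult_ac)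
    qed
  qed (auto simp: si)
  also have "\<dots> \<le> (a * L)\<^sup>2 * ((1 + \<gamma>) * (\<gamma> * \<phi> k + \<delta> k) + 7 * s)"
  proof (rule mult_left_mono)
    have R: "ip M ?R ?R \<le> (1 + \<gamma>) * (\<gamma> * \<phi> k + \<delta> k)"
    proof -
      have "(\<integral>\<omega>. (norm (?R \<omega>))\<^sup>2 \<partial>M) \<le>
          (\<integral>\<omega>. (1 + \<gamma>) * (\<gamma> * (norm (?f \<omega>))\<^sup>2 + (norm (?f \<omega> - ?f' \<omega>))\<^sup>2) \<partial>M)"
      proof (rule integral_mono)
        show "(norm (?R \<omega>))\<^sup>2 \<le> (1 + \<gamma>) * (\<gamma> * (norm (?f \<omega>))\<^sup>2 + (norm (?f \<omega> - ?f' \<omega>))\<^sup>2)" for \<omega>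
          using norm_add_sq_le[of \<gamma> "?f \<omega>" "?f \<omega> - ?f' \<omega>"] \<gamma> by (simp add: algebra_simps)
      qed (use si square_integrable_diff[OF si_f[of k] si_f[of "k - 1"]]
          square_integrable_diff[OF square_integrable_scaleR[OF si_f[of k]] si_f[of "k - 1"], of "1 + \<gamma>"]
          in \<open>auto simp: square_integrable_def\<close>)
      also have "\<dots> = (1 + \<gamma>) * (\<gamma> * \<phi> k + \<delta> k)"
        using si square_integrable_diff[OF si_f[of k] si_f[of "k - 1"]]
        by (simp add: \<phi>_def \<delta>_def ip_self_eq square_integrable_def)
      finally show ?thesis by (simp add: ip_self_eq)
    qed
    have Q: "ip M ?Q ?Q = ip M ?R ?R + (1 + \<gamma>)\<^sup>2 * ip M ?n ?n + ip M ?n' ?n'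
        - 2 * (1 + \<gamma>) * ip M ?n ?n' - 2 * (1 + \<gamma>) * ip M ?f ?n'"
    proof -
      let ?N = "\<lambda>\<omega>. (1 + \<gamma>) *\<^sub>R ?n \<omega> - ?n' \<omega>"
      have "?Q = (\<lambda>\<omega>. ?R \<omega> + 1 *\<^sub>R ?N \<omega>)" by (simp add: algebra_simps)
      moreover have "square_integrable M ?R" "square_integrable M ?N" by (auto simp: si)
      ultimately have "ip M ?Q ?Q = ip M ?R ?R + 2 * ip M ?R ?N + ip M ?N ?N"
        by (simp only: ip_self_add_scaleR) simp
      moreover have "ip M ?R ?N = - (1 + \<gamma>) * ip M ?f ?n'"
        using orth(1,2)[of "k - 1"] by (simp add: ip_simps si orth) (simp add: algebra_simps)
      moreover have "ip M ?N ?N = (1 + \<gamma>)\<^sup>2 * ip M ?n ?n - 2 * (1 + \<gamma>) * ip M ?n ?n' + ip M ?n' ?n'"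
        by (simp add: ip_simps si ip_commute[of M "n (k - Suc 0)" "n k"]) (simp add: power2_eq_square algebra_simps)
      ultimately show ?thesis by algebra
    qed
    \<comment> \<open>The 7 is \<open>4 + 1 + 2\<close>, from the current noise, the previous noise
      and its correlation with \<open>f k\<close>. For \<open>k = 0\<close> the noises coincide and
      only \<open>\<gamma>\<^sup>2\<close> times one variance remains.\<close>
    have noise: "(1 + \<gamma>)\<^sup>2 * ip M ?n ?n + ip M ?n' ?n' - 2 * (1 + \<gamma>) * ip M ?n ?n'
        - 2 * (1 + \<gamma>) * ip M ?f ?n' \<le> 7 * s"
    proof (cases "k = 0")
      case True
      have "\<gamma>\<^sup>2 * ip M (n 0) (n 0) \<le> 1 * s"
        using var[of 0] \<gamma> by (intro mult_mono) (auto simp: power_le_one)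
      then show ?thesis using True orth(2)[of 0] s_nonneg by (simp add: power2_eq_square algebra_simps)
    next
      case False
      have "(1 + \<gamma>)\<^sup>2 * ip M ?n ?n \<le> 2\<^sup>2 * s"
        using var[of k] \<gamma> by (intro mult_mono power_mono) auto
      moreover have "ip M ?n' ?n' \<le> s" by (rule var)
      moreover have "2 * (1 + \<gamma>) * (- (1 - \<gamma>) * s) \<le> 2 * (1 + \<gamma>) * ip M ?f ?n'"
        using ip_f_prev_noise[of k] False \<gamma> by (intro mult_left_mono) auto
      moreover have "0 \<le> \<gamma> * \<gamma> * s" using s_nonneg by simp
      ultimately show ?thesis using False orth(5)[of k] by (simp add: algebra_simps)
    qed
    show "ip M ?Q ?Q \<le> (1 + \<gamma>) * (\<gamma> * \<phi> k + \<delta> k) + 7 * s"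
      using R Q noise by linarith
  qed simp
  finally show ?thesis by (simp add: algebra_simps)
qed

lemma lipschitz_lower_bound: "\<phi> k * (1 / L\<^sup>2) \<le> ip M (\<lambda>\<omega>. u k \<omega> - ustar) (\<lambda>\<omega>. u k \<omega> - ustar)"
proof -
  have "F ustar = 0" using lip minty L_\<rho> by (rule weak_minty_zero)
  then have "norm (f k \<omega>) \<le> L * norm (u k \<omega> - ustar)" for \<omega>
    using lipschitz_onD[OF lip, of "u k \<omega>" ustar] by (simp add: f_def dist_norm)
  then have "\<phi> k \<le> L\<^sup>2 * ip M (\<lambda>\<omega>. u k \<omega> - ustar) (\<lambda>\<omega>. u k \<omega> - ustar)"
    unfolding \<phi>_def by (intro ip_self_mono) (auto simp: si)
  then show ?thesis using L_pos by (simp add: field_simps)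
qed

text \<open>The vector \<open>?P\<close> is estimated twice. From below, \<open>F ustar = 0\<close>
  and Minty give a multiple of \<open>\<phi> k\<close>; from above, \<open>?P\<close> splits into
  \<open>z (Suc k) - ustar\<close>, the increment and noise.\<close>

lemma boundary:
  defines "\<theta> \<equiv> (a * L)\<^sup>2 * (1 + \<gamma>)"
  shows "\<phi> k \<le> V (Suc k) / (a\<^sup>2 * \<gamma>) + \<theta> / (1 - \<theta>) * \<delta> k + 4 * s / \<gamma>"
proof -
  let ?f = "f k" and ?f' = "f (k - 1)" and ?n = "n k" and ?n' = "n (k - 1)"
  let ?P = "\<lambda>\<omega>. (u k \<omega> - ustar) + (a * (1 - \<gamma>)) *\<^sub>R ?f \<omega>"
  let ?x = "\<lambda>\<omega>. z (Suc k) \<omega> - ustar" and ?d = "\<lambda>\<omega>. ?f \<omega> - ?f' \<omega>"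
  let ?m = "\<lambda>\<omega>. \<gamma> *\<^sub>R ?n \<omega> - ?n' \<omega>"
  have \<theta>: "0 < \<theta>" "\<theta> < 1" using ogda_slack[OF aL \<gamma>(1)] by (simp_all add: \<theta>_def)
  \<comment> \<open>Chosen so that \<open>\<alpha> / \<gamma>\<close> is
    \<open>\<theta> / (1 - \<theta>)\<close>, the weight \<open>\<kappa>\<close> of
    \<open>\<delta>\<close> in \<open>ogda_summation\<close>.\<close>
  define \<alpha> where "\<alpha> = \<gamma> * \<theta> / (1 - \<theta>)"
  have \<alpha>: "0 < \<alpha>" using \<theta> \<gamma> by (simp add: \<alpha>_def)
  have si': "square_integrable M ?P" "square_integrable M ?x" "square_integrable M ?d" "square_integrable M ?m"
    by (auto simp: si si_z)
  have P: "?P \<omega> = ?x \<omega> + a *\<^sub>R ?d \<omega> + a *\<^sub>R ?m \<omega>" for \<omega>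
    by (simp add: z_def u_Suc f_def algebra_simps)
  have "(\<integral>\<omega>. (norm (?P \<omega>))\<^sup>2 \<partial>M) \<le>
      (\<integral>\<omega>. (2 + 1 / \<alpha>) * ((norm (?x \<omega>))\<^sup>2 + \<alpha> * (a\<^sup>2 * (norm (?d \<omega>))\<^sup>2) + a\<^sup>2 * (norm (?m \<omega>))\<^sup>2) \<partial>M)"
  proof (rule integral_mono)
    show "(norm (?P \<omega>))\<^sup>2 \<le>
        (2 + 1 / \<alpha>) * ((norm (?x \<omega>))\<^sup>2 + \<alpha> * (a\<^sup>2 * (norm (?d \<omega>))\<^sup>2) + a\<^sup>2 * (norm (?m \<omega>))\<^sup>2)" for \<omega>
      unfolding P using norm_add3_sq_le[OF \<alpha>, of "?x \<omega>" "a *\<^sub>R ?d \<omega>" "a *\<^sub>R ?m \<omega>"]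
      by (simp add: power_mult_distrib)
  qed (use si' in \<open>auto simp: square_integrable_def\<close>)
  also have "\<dots> = (2 + 1 / \<alpha>) * (V (Suc k) + \<alpha> * (a\<^sup>2 * \<delta> k) + a\<^sup>2 * ip M ?m ?m)"
    using si' by (simp add: V_def \<delta>_def ip_self_eq square_integrable_def)
  finally have upper: "ip M ?P ?P \<le> (2 + 1 / \<alpha>) * (V (Suc k) + \<alpha> * (a\<^sup>2 * \<delta> k) + a\<^sup>2 * ip M ?m ?m)"
    by (simp add: ip_self_eq)
  have m: "ip M ?m ?m \<le> 4 * s"
  proof -
    have "(\<integral>\<omega>. (norm (?m \<omega>))\<^sup>2 \<partial>M) \<le> (\<integral>\<omega>. (1 + \<gamma>) * (\<gamma> * (norm (?n \<omega>))\<^sup>2 + (norm (?n' \<omega>))\<^sup>2) \<partial>M)"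
    proof (rule integral_mono)
      show "(norm (?m \<omega>))\<^sup>2 \<le> (1 + \<gamma>) * (\<gamma> * (norm (?n \<omega>))\<^sup>2 + (norm (?n' \<omega>))\<^sup>2)" for \<omega>
        using norm_add_sq_le[of \<gamma> "?n \<omega>" "- ?n' \<omega>"] \<gamma> by simp
    qed (use si' si in \<open>auto simp: square_integrable_def\<close>)
    also have "\<dots> = (1 + \<gamma>) * (\<gamma> * ip M ?n ?n + ip M ?n' ?n')"
      using si by (simp add: ip_self_eq square_integrable_def)
    also have "\<dots> \<le> 2 * (1 * s + s)"
      using \<gamma> var[of k] var[of "k - 1"] s_nonneg by (intro mult_mono add_mono) auto
    finally show ?thesis by (simp add: ip_self_eq)
  qed
  have lower: "a\<^sup>2 * (1 / (a * L)\<^sup>2 - \<gamma> * (1 - \<gamma>)) * \<phi> k \<le> ip M ?P ?P"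
  proof -
    have "ip M ?P ?P = ip M (\<lambda>\<omega>. u k \<omega> - ustar) (\<lambda>\<omega>. u k \<omega> - ustar)
        + 2 * (a * (1 - \<gamma>)) * ip M ?f (\<lambda>\<omega>. u k \<omega> - ustar) + (a * (1 - \<gamma>))\<^sup>2 * \<phi> k"
      by (subst ip_self_add_scaleR) (auto simp: si \<phi>_def ip_commute[of M "f k" "\<lambda>\<omega>. u k \<omega> - ustar"])
    \<comment> \<open>Weakening \<open>\<rho>\<close> to \<open>a\<close> makes the lower
      coefficient, up to \<open>a\<^sup>2\<close>, depend on \<open>a * L\<close> and
      \<open>\<gamma>\<close> alone.\<close>
    moreover have "2 * (a * (1 - \<gamma>)) * (- (a / 2) * \<phi> k) \<le> 2 * (a * (1 - \<gamma>)) * ip M ?f (\<lambda>\<omega>. u k \<omega> - ustar)"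
    proof (intro mult_left_mono)
      have "\<rho> / 2 * \<phi> k \<le> a / 2 * \<phi> k" using a by (intro mult_right_mono) (auto simp: \<phi>_def)
      then show "- (a / 2) * \<phi> k \<le> ip M ?f (\<lambda>\<omega>. u k \<omega> - ustar)" using ip_f_minty[of k] by simp
    qed (use \<gamma> a_pos in simp)
    moreover have "a\<^sup>2 * (1 / (a * L)\<^sup>2 - \<gamma> * (1 - \<gamma>)) * \<phi> k
        = \<phi> k * (1 / L\<^sup>2) + 2 * (a * (1 - \<gamma>)) * (- (a / 2) * \<phi> k) + (a * (1 - \<gamma>))\<^sup>2 * \<phi> k"
      using a_pos L_pos by (simp add: field_simps power2_eq_square)
    ultimately show ?thesis using lipschitz_lower_bound[of k] by linarith
  qed
  have "\<gamma> * (2 + 1 / \<alpha>) \<le> 1 / (a * L)\<^sup>2 - \<gamma> * (1 - \<gamma>)"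
    using ogda_boundary_weight[OF aL \<gamma>(1)] by (simp add: \<alpha>_def \<theta>_def)
  then have "a\<^sup>2 * (\<gamma> * (2 + 1 / \<alpha>)) * \<phi> k \<le> a\<^sup>2 * (1 / (a * L)\<^sup>2 - \<gamma> * (1 - \<gamma>)) * \<phi> k"
    by (intro mult_right_mono mult_left_mono) (auto simp: \<phi>_def)
  also note lower
  also note upper
  finally have "(2 + 1 / \<alpha>) * (a\<^sup>2 * \<gamma> * \<phi> k) \<le> (2 + 1 / \<alpha>) * (V (Suc k) + \<alpha> * (a\<^sup>2 * \<delta> k) + a\<^sup>2 * ip M ?m ?m)"
    by (simp add: mult_ac)
  then have "a\<^sup>2 * \<gamma> * \<phi> k \<le> V (Suc k) + \<alpha> * (a\<^sup>2 * \<delta> k) + a\<^sup>2 * ip M ?m ?m"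
    using \<alpha> by (subst (asm) mult_le_cancel_left_pos) (auto intro: add_pos_pos)
  also have "\<dots> \<le> V (Suc k) + \<alpha> * (a\<^sup>2 * \<delta> k) + a\<^sup>2 * (4 * s)"
    using m by (intro add_left_mono mult_left_mono) auto
  also have "\<dots> = a\<^sup>2 * \<gamma> * (V (Suc k) / (a\<^sup>2 * \<gamma>) + \<theta> / (1 - \<theta>) * \<delta> k + 4 * s / \<gamma>)"
    using a_pos \<gamma> \<theta> by (simp add: \<alpha>_def field_simps)
  finally show ?thesis using a_pos \<gamma> by (subst (asm) mult_le_cancel_left_pos) auto
qed

theorem sum_bound:
  "((a - \<rho>) + a * (a * L) * (1 - a * L)) * (\<Sum>k\<le>m. \<phi> k) \<le>
    V 0 / (a * \<gamma>) + a * s * (real (Suc m) * (2 + 7 * (a * L)\<^sup>2 / (1 - (a * L)\<^sup>2 * (1 + \<gamma>))) + 4 / \<gamma>)"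
proof -
  note slack = ogda_slack[OF aL \<gamma>(1)]
  have \<phi>: "0 \<le> \<phi> k" and \<delta>0: "\<delta> 0 = 0" for k by (simp_all add: \<phi>_def \<delta>_def ip_def)
  show ?thesis
    by (rule ogda_summation[where \<theta> = "(a * L)\<^sup>2 * (1 + \<gamma>)", OF a_pos \<gamma>(1) less_imp_le[OF slack(1)]
        slack(4,6) \<phi> s_nonneg energy increment \<delta>0 boundary])
qed

text \<open>The noise in \<open>z 0\<close> is orthogonal to the rest and only increases
  \<open>V 0\<close>. In the rest, Minty leaves the nonnegative surplus
  \<open>a * (a - \<rho>) * \<phi> 0\<close>.\<close>

lemma V0_lower_bound: "\<phi> 0 * (1 / L\<^sup>2) \<le> V 0"
proof -
  let ?P = "\<lambda>\<omega>. (u 0 \<omega> - ustar) + a *\<^sub>R f 0 \<omega>"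
  have X: "z 0 \<omega> - ustar = ?P \<omega> + a *\<^sub>R n 0 \<omega>" for \<omega>
    by (simp add: z_def algebra_simps)
  have o: "ip M (n 0) ?P = 0"
  proof -
    have "square_integrable M (\<lambda>\<omega>. u 0 \<omega> - ustar)" by (auto simp: si)
    then have "ip M (n 0) ?P = ip M (n 0) (\<lambda>\<omega>. u 0 \<omega> - ustar) + a * ip M (n 0) (f 0)"
      by (subst ip_add_right) (auto simp: si ip_scaleR_right)
    then show ?thesis using orth_u[of 0] orth(1)[of 0] by simp
  qed
  have sP: "square_integrable M ?P" by (auto simp: si)
  have "V 0 = ip M ?P ?P + a\<^sup>2 * ip M (n 0) (n 0)"
    unfolding V_def X using o
    by (subst ip_self_add_scaleR[OF sP si_n]) (simp add: ip_commute[of M ?P "n 0"])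
  then have "ip M ?P ?P \<le> V 0" by simp
  moreover have "ip M ?P ?P = ip M (\<lambda>\<omega>. u 0 \<omega> - ustar) (\<lambda>\<omega>. u 0 \<omega> - ustar)
        + 2 * a * ip M (f 0) (\<lambda>\<omega>. u 0 \<omega> - ustar) + a\<^sup>2 * \<phi> 0"
    by (subst ip_self_add_scaleR) (auto simp: si \<phi>_def ip_commute[of M "f 0" "\<lambda>\<omega>. u 0 \<omega> - ustar"])
  moreover have "2 * a * (- (\<rho> / 2) * \<phi> 0) \<le> 2 * a * ip M (f 0) (\<lambda>\<omega>. u 0 \<omega> - ustar)"
    using ip_f_minty[of 0] a_pos by (intro mult_left_mono) auto
  moreover have "0 \<le> (a * (a - \<rho>)) * \<phi> 0" using a a_pos by (intro mult_nonneg_nonneg) (auto simp: \<phi>_def)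
  ultimately show ?thesis
    using lipschitz_lower_bound[of 0]
    by (simp only: power2_eq_square right_diff_distrib left_diff_distrib)
qed

end

section \<open>Independence of the samples\<close>

text \<open>Stated as a measurable factorization through the tuple of samples, so that Fubini can be
  applied to the factor \<open>y\<close>.\<close>

definition depends_on :: "'s measure \<Rightarrow> ('i \<Rightarrow> 'w \<Rightarrow> 's) \<Rightarrow> 'i set \<Rightarrow> ('w \<Rightarrow> 'b::topological_space) \<Rightarrow> bool" where
  "depends_on D X J Y \<longleftrightarrow>
     (\<exists>y \<in> borel_measurable (Pi\<^sub>M J (\<lambda>_. D)). \<forall>\<omega>. Y \<omega> = y (\<lambda>j\<in>J. X j \<omega>))"

lemma depends_onE:
  assumes "depends_on D X J Y"
  obtains y where "y \<in> borel_measurable (Pi\<^sub>M J (\<lambda>_. D))" "Y = (\<lambda>\<omega>. y (\<lambda>j\<in>J. X j \<omega>))"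
  using assms unfolding depends_on_def fun_eq_iff by blast

lemma depends_on_const [intro, simp]: "depends_on D X J (\<lambda>\<omega>. c)"
  unfolding depends_on_def by (rule bexI[of _ "\<lambda>_. c"]) auto

lemma depends_on_comp:
  assumes Y: "depends_on D X J Y" and h: "h \<in> borel_measurable borel"
  shows "depends_on D X J (\<lambda>\<omega>. h (Y \<omega>))"
proof -
  obtain y where "y \<in> borel_measurable (Pi\<^sub>M J (\<lambda>_. D))" "Y = (\<lambda>\<omega>. y (\<lambda>j\<in>J. X j \<omega>))"
    using Y by (blast elim: depends_onE)
  then show ?thesis unfolding depends_on_def
    by (intro bexI[of _ "\<lambda>w. h (y w)"]) (auto intro: measurable_compose[OF _ h])
qed

lemma depends_on_add [intro]:
  fixes Y Z :: "'w \<Rightarrow> 'b::euclidean_space"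
  assumes "depends_on D X J Y" "depends_on D X J Z"
  shows "depends_on D X J (\<lambda>\<omega>. Y \<omega> + Z \<omega>)"
proof -
  obtain y where y: "y \<in> borel_measurable (Pi\<^sub>M J (\<lambda>_. D))" "Y = (\<lambda>\<omega>. y (\<lambda>j\<in>J. X j \<omega>))"
    using assms(1) by (blast elim: depends_onE)
  obtain z where "z \<in> borel_measurable (Pi\<^sub>M J (\<lambda>_. D))" "Z = (\<lambda>\<omega>. z (\<lambda>j\<in>J. X j \<omega>))"
    using assms(2) by (blast elim: depends_onE)
  with y show ?thesis unfolding depends_on_def
    by (intro bexI[of _ "\<lambda>w. y w + z w"]) auto
qed

lemma depends_on_scaleR [intro]:
  fixes Y :: "'w \<Rightarrow> 'b::euclidean_space"
  assumes "depends_on D X J Y"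
  shows "depends_on D X J (\<lambda>\<omega>. c *\<^sub>R Y \<omega>)"
  using assms by (rule depends_on_comp) simp

lemma depends_on_diff [intro]:
  fixes Y Z :: "'w \<Rightarrow> 'b::euclidean_space"
  assumes "depends_on D X J Y" "depends_on D X J Z"
  shows "depends_on D X J (\<lambda>\<omega>. Y \<omega> - Z \<omega>)"
  using depends_on_add[OF assms(1) depends_on_scaleR[OF assms(2), of "-1"]] by simp

lemma depends_on_sum:
  fixes Y :: "'k \<Rightarrow> 'w \<Rightarrow> 'b::euclidean_space"
  assumes "\<And>i. i \<in> I \<Longrightarrow> depends_on D X J (Y i)"
  shows "depends_on D X J (\<lambda>\<omega>. \<Sum>i\<in>I. Y i \<omega>)"
  using assms by (induction I rule: infinite_finite_induct) auto

lemma depends_on_sample: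
  fixes Y :: "'w \<Rightarrow> 'b::topological_space" and h :: "'b \<Rightarrow> 's \<Rightarrow> 'c::topological_space"
  assumes Y: "depends_on D X J Y" and j: "j \<in> J"
    and h: "(\<lambda>(x, s). h x s) \<in> borel_measurable (borel \<Otimes>\<^sub>M D)"
  shows "depends_on D X J (\<lambda>\<omega>. h (Y \<omega>) (X j \<omega>))"
proof -
  obtain y where y: "y \<in> borel_measurable (Pi\<^sub>M J (\<lambda>_. D))" "Y = (\<lambda>\<omega>. y (\<lambda>j\<in>J. X j \<omega>))"
    using Y by (blast elim: depends_onE)
  have "(\<lambda>w. (y w, w j)) \<in> Pi\<^sub>M J (\<lambda>_. D) \<rightarrow>\<^sub>M borel \<Otimes>\<^sub>M D"
    using y(1) j by measurable
  from measurable_compose[OF this h]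
  have "(\<lambda>w. h (y w) (w j)) \<in> borel_measurable (Pi\<^sub>M J (\<lambda>_. D))" by simp
  then show ?thesis unfolding depends_on_def
    by (intro bexI[of _ "\<lambda>w. h (y w) (w j)"]) (auto simp: y(2) j)
qed

lemma depends_on_measurable:
  assumes "depends_on D X J Y" "\<And>j. X j \<in> M \<rightarrow>\<^sub>M D"
  shows "Y \<in> borel_measurable M"
proof -
  obtain y where y: "y \<in> borel_measurable (Pi\<^sub>M J (\<lambda>_. D))" "Y = (\<lambda>\<omega>. y (\<lambda>j\<in>J. X j \<omega>))"
    using assms(1) by (blast elim: depends_onE)
  have "(\<lambda>\<omega>. \<lambda>j\<in>J. X j \<omega>) \<in> M \<rightarrow>\<^sub>M Pi\<^sub>M J (\<lambda>_. D)"
    using assms(2) by (intro measurable_restrict) auto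
  then show ?thesis using measurable_compose[OF _ y(1)] by (simp add: y(2))
qed

section \<open>Integrating out a sample independent of the others\<close>

locale iid_family = prob_space M for M :: "'w measure" +
  fixes D :: "'s measure" and X :: "'i \<Rightarrow> 'w \<Rightarrow> 's"
  assumes indep: "indep_vars (\<lambda>_. D) X UNIV"
    and distr_X: "\<And>j. distr M D (X j) = D"
begin

lemma X_measurable [measurable]: "X j \<in> M \<rightarrow>\<^sub>M D"
  using indep by (auto simp: indep_vars_def)

lemma prob_space_D: "prob_space D"
  using prob_space_distr[OF X_measurable] distr_X by metis

text \<open>As \<open>j\<close> lies outside \<open>J\<close>, the joint law of \<open>W\<close> and
  \<open>X j\<close> is the product of the law of \<open>W\<close> with \<open>D\<close>; all three
  claims are then Fubini.\<close>

lemma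
  fixes h :: "('i \<Rightarrow> 's) \<times> 's \<Rightarrow> real" and J :: "'i set"
  defines "W \<equiv> \<lambda>\<omega>. \<lambda>i\<in>J. X i \<omega>"
  assumes j: "j \<notin> J" and h: "h \<in> borel_measurable (Pi\<^sub>M J (\<lambda>_. D) \<Otimes>\<^sub>M D)"
    and int: "integrable M (\<lambda>\<omega>. h (W \<omega>, X j \<omega>))"
  shows fresh_AE_integrable: "AE \<omega> in M. integrable D (\<lambda>s. h (W \<omega>, s))"
    and fresh_integrable: "integrable M (\<lambda>\<omega>. \<integral>s. h (W \<omega>, s) \<partial>D)"
    and fresh_integral: "(\<integral>\<omega>. h (W \<omega>, X j \<omega>) \<partial>M) = (\<integral>\<omega>. (\<integral>s. h (W \<omega>, s) \<partial>D) \<partial>M)"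
proof -
  let ?P = "Pi\<^sub>M J (\<lambda>_. D)"
  have W: "W \<in> M \<rightarrow>\<^sub>M ?P" unfolding W_def by (intro measurable_restrict) simp
  \<comment> \<open>Independence of restrictions concerns tuples, so \<open>X j\<close> first
    appears as a one-element tuple; evaluation at \<open>j\<close> turns its law into
    \<open>D\<close>.\<close>
  let ?Q = "Pi\<^sub>M {j} (\<lambda>_. D)" and ?V = "\<lambda>\<omega>. \<lambda>i\<in>{j}. X i \<omega>"
  have V: "?V \<in> M \<rightarrow>\<^sub>M ?Q" by (intro measurable_restrict) simp
  interpret D: prob_space D by (rule prob_space_D)
  have "indep_var ?P W ?Q ?V"
    unfolding W_def using j by (intro indep_var_restrict[OF indep]) auto
  then have VW: "distr M ?P W \<Otimes>\<^sub>M distr M ?Q ?V = distr M (?P \<Otimes>\<^sub>M ?Q) (\<lambda>\<omega>. (W \<omega>, ?V \<omega>))"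
    unfolding indep_var_distribution_eq by simp
  have D_eq: "distr (distr M ?Q ?V) D (\<lambda>v. v j) = D"
    using V by (subst distr_distr) (auto simp: comp_def distr_X)
  have "distr M ?P W \<Otimes>\<^sub>M D =
      distr (distr M ?P W) ?P (\<lambda>w. w) \<Otimes>\<^sub>M distr (distr M ?Q ?V) D (\<lambda>v. v j)"
    by (simp add: D_eq distr_distr comp_def W)
  also have "\<dots> = distr (distr M ?P W \<Otimes>\<^sub>M distr M ?Q ?V) (?P \<Otimes>\<^sub>M D) (\<lambda>(w, v). (w, v j))"
    by (rule pair_measure_distr) (auto simp: D_eq D.sigma_finite_measure_axioms)
  also have "\<dots> = distr M (?P \<Otimes>\<^sub>M D) (\<lambda>\<omega>. (W \<omega>, X j \<omega>))"
    unfolding VW using V W by (subst distr_distr) (auto simp: comp_def)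
  finally have eq: "distr M ?P W \<Otimes>\<^sub>M D = distr M (?P \<Otimes>\<^sub>M D) (\<lambda>\<omega>. (W \<omega>, X j \<omega>))" .
  interpret P: prob_space "distr M ?P W" by (rule prob_space_distr) (rule W)
  interpret pair_sigma_finite "distr M ?P W" D ..
  have WX: "(\<lambda>\<omega>. (W \<omega>, X j \<omega>)) \<in> M \<rightarrow>\<^sub>M ?P \<Otimes>\<^sub>M D" using W by measurable
  have h': "integrable (distr M ?P W \<Otimes>\<^sub>M D) h"
    unfolding eq using int h WX by (simp add: integrable_distr_eq)
  show "AE \<omega> in M. integrable D (\<lambda>s. h (W \<omega>, s))"
    by (rule AE_distrD[OF W AE_integrable_fst'[OF h']])
  have m: "(\<lambda>w. \<integral>s. h (w, s) \<partial>D) \<in> borel_measurable ?P"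
    using h by (intro D.borel_measurable_lebesgue_integral) simp
  show "integrable M (\<lambda>\<omega>. \<integral>s. h (W \<omega>, s) \<partial>D)"
    using integrable_fst'[OF h'] m W by (simp add: integrable_distr_eq)
  have "(\<integral>\<omega>. h (W \<omega>, X j \<omega>) \<partial>M) = (\<integral>x. h x \<partial>(distr M ?P W \<Otimes>\<^sub>M D))"
    unfolding eq using h WX by (simp add: integral_distr)
  also have "\<dots> = (\<integral>w. (\<integral>s. h (w, s) \<partial>D) \<partial>distr M ?P W)"
    by (rule integral_fst'[OF h', symmetric])
  also have "\<dots> = (\<integral>\<omega>. (\<integral>s. h (W \<omega>, s) \<partial>D) \<partial>M)"
    by (rule integral_distr[OF W m])
  finally show "(\<integral>\<omega>. h (W \<omega>, X j \<omega>) \<partial>M) = (\<integral>\<omega>. (\<integral>s. h (W \<omega>, s) \<partial>D) \<partial>M)" .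
qed

text \<open>Since the sample \<open>X j\<close> is independent of \<open>U\<close>, conditioning on \<open>U\<close> means integrating over the
  law of the sample with \<open>U\<close> held fixed. This upgrades unbiasedness given \<open>U\<close> to unbiasedness
  given all the other samples.\<close>

lemma fresh_mean:
  fixes F :: "'a::euclidean_space \<Rightarrow> 'a" and h :: "'a \<Rightarrow> 's \<Rightarrow> 'a"
  assumes j: "j \<notin> J" and U: "depends_on D X J U"
    and h: "(\<lambda>(x, s). h x s) \<in> borel_measurable (borel \<Otimes>\<^sub>M D)"
    and unbiased: "cond_expectation_eq M (\<lambda>\<omega>. h (U \<omega>) (X j \<omega>)) U (\<lambda>\<omega>. F (U \<omega>))"
    and b: "b \<in> Basis"
  shows "AE \<omega> in M. (\<integral>s. h (U \<omega>) s \<bullet> b \<partial>D) = F (U \<omega>) \<bullet> b"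
proof -
  obtain U' where U'[measurable]: "U' \<in> borel_measurable (Pi\<^sub>M J (\<lambda>_. D))"
    and U_eq: "U = (\<lambda>\<omega>. U' (\<lambda>i\<in>J. X i \<omega>))"
    using U by (blast elim: depends_onE)
  note [measurable] = h depends_on_measurable[OF U X_measurable]
  interpret D: prob_space D by (rule prob_space_D)
  let ?G = "vimage_algebra (space M) U borel"
  have "subalgebra M ?G"
    unfolding subalgebra_def using depends_on_measurable[OF U X_measurable]
    by (simp add: sets_image_in_sets)
  then interpret finite_measure_subalgebra M ?G by unfold_locales
  have int: "integrable M (\<lambda>\<omega>. h (U \<omega>) (X j \<omega>) \<bullet> b)"
    using unbiased by (simp add: cond_expectation_eq_def)
  have hb: "(\<lambda>(w, s). h (U' w) s \<bullet> b) \<in> borel_measurable (Pi\<^sub>M J (\<lambda>_. D) \<Otimes>\<^sub>M D)" by measurable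
  have "AE \<omega> in M. real_cond_exp M ?G (\<lambda>\<omega>. h (U \<omega>) (X j \<omega>) \<bullet> b) \<omega> = (\<integral>s. h (U \<omega>) s \<bullet> b \<partial>D)"
  proof (rule real_cond_exp_charact)
    show "integrable M (\<lambda>\<omega>. \<integral>s. h (U \<omega>) s \<bullet> b \<partial>D)"
      using fresh_integrable[OF j hb] int by (simp add: U_eq)
    have "(\<lambda>x. \<integral>s. h x s \<bullet> b \<partial>D) \<in> borel_measurable borel" by measurable
    moreover have "U \<in> ?G \<rightarrow>\<^sub>M borel" by (rule measurable_vimage_algebra1) simp
    ultimately show "(\<lambda>\<omega>. \<integral>s. h (U \<omega>) s \<bullet> b \<partial>D) \<in> borel_measurable ?G"
      by (rule measurable_compose[rotated])
    fix A assume "A \<in> sets ?G"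
    then obtain A' where A'[measurable]: "A' \<in> sets borel" and A: "A = U -` A' \<inter> space M"
      by (auto simp: sets_vimage_algebra2)
    have Am: "A \<in> sets M" unfolding A by measurable
    \<comment> \<open>The indicator of an event generated by \<open>U\<close> is a function of the
      samples in \<open>J\<close>, so it stays fixed while \<open>X j\<close> is integrated
      out.\<close>
    let ?h = "\<lambda>(w, s). indicator A' (U' w) * (h (U' w) s \<bullet> b)"
    have hm: "?h \<in> borel_measurable (Pi\<^sub>M J (\<lambda>_. D) \<Otimes>\<^sub>M D)" by measurable
    have ind: "indicator A \<omega> = (indicator A' (U \<omega>) :: real)" if "\<omega> \<in> space M" for \<omega>
      using that by (auto simp: A indicator_def)
    have "integrable M (\<lambda>\<omega>. indicator A' (U \<omega>) * (h (U \<omega>) (X j \<omega>) \<bullet> b))"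
    proof -
      have "integrable M (\<lambda>\<omega>. indicator A \<omega> * (h (U \<omega>) (X j \<omega>) \<bullet> b))"
        using integrable_mult_indicator[OF Am int] by simp
      then show ?thesis by (rule Bochner_Integration.integrable_cong[THEN iffD1, rotated 2]) (auto simp: ind)
    qed
    then have "(\<integral>\<omega>. indicator A' (U \<omega>) * (h (U \<omega>) (X j \<omega>) \<bullet> b) \<partial>M) =
        (\<integral>\<omega>. (\<integral>s. indicator A' (U \<omega>) * (h (U \<omega>) s \<bullet> b) \<partial>D) \<partial>M)"
      using fresh_integral[OF j hm] by (simp add: U_eq)
    then show "(\<integral>\<omega>\<in>A. h (U \<omega>) (X j \<omega>) \<bullet> b \<partial>M) = (\<integral>\<omega>\<in>A. (\<integral>s. h (U \<omega>) s \<bullet> b \<partial>D) \<partial>M)"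
      unfolding set_lebesgue_integral_def by (simp add: ind cong: Bochner_Integration.integral_cong)
  qed (rule int)
  moreover have "AE \<omega> in M. real_cond_exp M ?G (\<lambda>\<omega>. h (U \<omega>) (X j \<omega>) \<bullet> b) \<omega> = F (U \<omega>) \<bullet> b"
    using unbiased b by (simp add: cond_expectation_eq_def)
  ultimately show ?thesis by eventually_elim simp
qed

text \<open>With the samples in \<open>J\<close> held fixed, \<open>Y\<close> is constant and each
  coordinate of the noise integrates to zero over the fresh sample, by
  \<open>fresh_mean\<close>.\<close>

lemma fresh_noise_orthogonal:
  fixes F :: "'a::euclidean_space \<Rightarrow> 'a" and h :: "'a \<Rightarrow> 's \<Rightarrow> 'a"
  defines "N U j \<equiv> \<lambda>\<omega>. h (U \<omega>) (X j \<omega>) - F (U \<omega>)"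
  assumes j: "j \<notin> J" and U: "depends_on D X J U" and Y: "depends_on D X J Y"
    and h: "(\<lambda>(x, s). h x s) \<in> borel_measurable (borel \<Otimes>\<^sub>M D)"
    and F[measurable]: "F \<in> borel_measurable borel"
    and unbiased: "cond_expectation_eq M (\<lambda>\<omega>. h (U \<omega>) (X j \<omega>)) U (\<lambda>\<omega>. F (U \<omega>))"
    and si_N: "square_integrable M (N U j)" and si_Y: "square_integrable M Y"
  shows "ip M (N U j) Y = 0"
proof -
  obtain U' where U'[measurable]: "U' \<in> borel_measurable (Pi\<^sub>M J (\<lambda>_. D))"
    and U_eq: "U = (\<lambda>\<omega>. U' (\<lambda>i\<in>J. X i \<omega>))"
    using U by (blast elim: depends_onE)
  obtain Y' where Y'[measurable]: "Y' \<in> borel_measurable (Pi\<^sub>M J (\<lambda>_. D))"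
    and Y_eq: "Y = (\<lambda>\<omega>. Y' (\<lambda>i\<in>J. X i \<omega>))"
    using Y by (blast elim: depends_onE)
  note [measurable] = h
  interpret D: prob_space D by (rule prob_space_D)
  have comp: "integrable M (\<lambda>\<omega>. (N U j \<omega> \<bullet> b) * (Y \<omega> \<bullet> b))"
    and zero: "(\<integral>\<omega>. (N U j \<omega> \<bullet> b) * (Y \<omega> \<bullet> b) \<partial>M) = 0" if b: "b \<in> Basis" for b
  proof -
    \<comment> \<open>A coordinate is put back on its axis so that the integrability result for
      vector inner products yields that of a product of coordinates.\<close>
    have coord: "square_integrable M (\<lambda>\<omega>. (Z \<omega> \<bullet> b) *\<^sub>R b)" if Z: "square_integrable M Z" for Z
    proof (rule square_integrable_bound[OF _ Z])
      show "(\<lambda>\<omega>. (Z \<omega> \<bullet> b) *\<^sub>R b) \<in> borel_measurable M"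
        using square_integrable_measurable[OF Z] by measurable
      show "norm ((Z \<omega> \<bullet> b) *\<^sub>R b) \<le> norm (Z \<omega>)" for \<omega>
        using b by (simp add: Basis_le_norm)
    qed
    show int: "integrable M (\<lambda>\<omega>. (N U j \<omega> \<bullet> b) * (Y \<omega> \<bullet> b))"
      using integrable_inner_square_integrable[OF coord[OF si_N] coord[OF si_Y]] b
      by (simp add: inner_Basis mult.commute)
    let ?h = "\<lambda>(w, s). ((h (U' w) s - F (U' w)) \<bullet> b) * (Y' w \<bullet> b)"
    have hm: "?h \<in> borel_measurable (Pi\<^sub>M J (\<lambda>_. D) \<Otimes>\<^sub>M D)" by measurable
    have hb: "(\<lambda>(w, s). h (U' w) s \<bullet> b) \<in> borel_measurable (Pi\<^sub>M J (\<lambda>_. D) \<Otimes>\<^sub>M D)" by measurable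
    have intb: "integrable M (\<lambda>\<omega>. h (U \<omega>) (X j \<omega>) \<bullet> b)"
      using unbiased by (simp add: cond_expectation_eq_def)
    have "(\<integral>\<omega>. (N U j \<omega> \<bullet> b) * (Y \<omega> \<bullet> b) \<partial>M) =
        (\<integral>\<omega>. (\<integral>s. ((h (U \<omega>) s - F (U \<omega>)) \<bullet> b) * (Y \<omega> \<bullet> b) \<partial>D) \<partial>M)"
      using fresh_integral[OF j hm] int by (simp add: U_eq Y_eq N_def)
    also have "\<dots> = (\<integral>\<omega>. 0 \<partial>M)"
    proof (rule integral_cong_AE)
      show "AE \<omega> in M. (\<integral>s. ((h (U \<omega>) s - F (U \<omega>)) \<bullet> b) * (Y \<omega> \<bullet> b) \<partial>D) = 0"
      proof -
        have "AE \<omega> in M. integrable D (\<lambda>s. h (U \<omega>) s \<bullet> b)"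
          using fresh_AE_integrable[OF j hb] intb by (simp add: U_eq)
        with fresh_mean[OF j U h unbiased b] show ?thesis
        proof eventually_elim
          case (elim \<omega>)
          have "(\<integral>s. ((h (U \<omega>) s - F (U \<omega>)) \<bullet> b) \<partial>D) = 0"
            using elim by (simp add: inner_diff_left D.prob_space)
          then show ?case by simp
        qed
      qed
      have "integrable M (\<lambda>\<omega>. \<integral>s. ((h (U \<omega>) s - F (U \<omega>)) \<bullet> b) * (Y \<omega> \<bullet> b) \<partial>D)"
        using fresh_integrable[OF j hm] int by (simp add: U_eq Y_eq N_def)
      then show "(\<lambda>\<omega>. \<integral>s. ((h (U \<omega>) s - F (U \<omega>)) \<bullet> b) * (Y \<omega> \<bullet> b) \<partial>D) \<in> borel_measurable M"
        by (rule borel_measurable_integrable)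
    qed simp
    finally show "(\<integral>\<omega>. (N U j \<omega> \<bullet> b) * (Y \<omega> \<bullet> b) \<partial>M) = 0" by simp
  qed
  have "ip M (N U j) Y = (\<integral>\<omega>. (\<Sum>b\<in>Basis. (N U j \<omega> \<bullet> b) * (Y \<omega> \<bullet> b)) \<partial>M)"
    unfolding ip_def by (subst euclidean_inner) simp
  also have "\<dots> = 0" using comp zero by (subst Bochner_Integration.integral_sum) auto
  finally show ?thesis .
qed

end

section \<open>Complexity of stochastic OGDA+\<close>

locale ogda_run = prob_space M
  for M :: "'w measure" +
  fixes D :: "'s measure" and \<xi> :: "nat \<Rightarrow> nat \<Rightarrow> 'w \<Rightarrow> 's"
    and Ft :: "'a::euclidean_space \<Rightarrow> 's \<Rightarrow> 'a" and F :: "'a \<Rightarrow> 'a"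
    and L \<rho> a \<gamma> \<sigma> :: real and u0 ustar :: 'a and B :: nat
  assumes stochastic: "stochastic_oracle M D \<xi> Ft F \<sigma> (ogda_plus Ft \<xi> a \<gamma> u0)"
    and B: "1 \<le> B"
    and lip: "L-lipschitz_on UNIV F"
    and minty: "weak_minty_solution F \<rho> ustar"
    and L_\<rho>: "\<rho> < 1 / L"
    and \<gamma>: "0 < \<gamma>" "\<gamma> \<le> 1"
    and a: "\<rho> < a" "a < (1 - \<gamma>) / (1 + \<gamma>) * (1 / L)"
begin

definition u where "u k = ogda_plus Ft \<xi> a \<gamma> u0 B k"
definition g where "g k = (\<lambda>\<omega>. batch_estimator Ft \<xi> B k (u k \<omega>) \<omega>)"
definition n where "n k = (\<lambda>\<omega>. g k \<omega> - F (u k \<omega>))"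
definition N where "N k i = (\<lambda>\<omega>. Ft (u k \<omega>) (\<xi> k i \<omega>) - F (u k \<omega>))"

text \<open>The value of \<open>F\<close> at the iterate \<open>u\<^sub>k\<^sub>+\<^sub>1\<close> with the noise of the \<open>k\<close>-th estimator removed. In the
  first step this estimator enters the update twice.\<close>

definition fh where "fh k = (\<lambda>\<omega>. F (if k = 0 then u0 - (a * \<gamma>) *\<^sub>R F u0
    else u k \<omega> - a *\<^sub>R ((1 + \<gamma>) *\<^sub>R F (u k \<omega>) - g (k - 1) \<omega>)))"

abbreviation X :: "nat \<times> nat \<Rightarrow> 'w \<Rightarrow> 's" where "X \<equiv> \<lambda>(k, i). \<xi> k i"

sublocale iid_family M D X
  using stochastic by unfold_locales (auto simp: stochastic_oracle_def iid_samples_def)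

lemma Ft_measurable: "(\<lambda>(x, s). Ft x s) \<in> borel_measurable (borel \<Otimes>\<^sub>M D)"
  using stochastic by (simp add: stochastic_oracle_def)

lemma F_measurable: "F \<in> borel_measurable borel"
  using lipschitz_on_continuous_on[OF lip] by (rule borel_measurable_continuous_onI)

lemma estimator_at:
  assumes "i < B"
  shows "cond_expectation_eq M (\<lambda>\<omega>. Ft (u k \<omega>) (\<xi> k i \<omega>)) (u k) (\<lambda>\<omega>. F (u k \<omega>))"
    and "integrable M (\<lambda>\<omega>. (norm (N k i \<omega>))\<^sup>2)"
    and "(\<integral>\<omega>. (norm (N k i \<omega>))\<^sup>2 \<partial>M) \<le> \<sigma>\<^sup>2"
  using stochastic B assms by (auto simp: stochastic_oracle_def u_def N_def)

lemma u_0: "u 0 \<omega> = u0"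
  by (simp add: u_def)

text \<open>Truncated subtraction gives \<open>g (0 - 1) = g 0\<close>, merging the first step with
  the later ones.\<close>

lemma u_Suc: "u (Suc k) \<omega> = u k \<omega> - a *\<^sub>R ((1 + \<gamma>) *\<^sub>R g k \<omega> - g (k - 1) \<omega>)"
  by (cases k) (simp_all add: u_def g_def)

lemma g_eq: "g k \<omega> = F (u k \<omega>) + n k \<omega>"
  by (simp add: n_def)

lemma n_eq: "n k = (\<lambda>\<omega>. (1 / real B) *\<^sub>R (\<Sum>i<B. N k i \<omega>))"
  using B by (simp add: n_def N_def g_def batch_estimator_def sum_subtractf scaleR_diff_right
      sum_constant_scaleR fun_eq_iff)

lemma depends_on_Ft:
  assumes "depends_on D X J (u k)" "(k, i) \<in> J"
  shows "depends_on D X J (\<lambda>\<omega>. Ft (u k \<omega>) (\<xi> k i \<omega>))"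
  using depends_on_sample[OF assms Ft_measurable] by simp

lemma depends_on_g_u:
  assumes "depends_on D X J (u k)" "\<And>i. (k, i) \<in> J"
  shows "depends_on D X J (g k)"
  unfolding g_def batch_estimator_def
  by (intro depends_on_scaleR depends_on_sum depends_on_Ft assms)

lemma depends_on_u: "(\<And>j i. j < k \<Longrightarrow> (j, i) \<in> J) \<Longrightarrow> depends_on D X J (u k)"
proof (induction k rule: less_induct)
  case (less k)
  show ?case
  proof (cases k)
    case 0
    then show ?thesis by (simp add: u_0[abs_def])
  next
    case (Suc j)
    have "depends_on D X J (u j)" "depends_on D X J (u (j - 1))"
      using less.prems by (auto intro!: less.IH simp: Suc)
    moreover have "depends_on D X J (g j)" "depends_on D X J (g (j - 1))"
      using calculation less.prems by (auto intro!: depends_on_g_u simp: Suc)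
    ultimately show ?thesis
      unfolding Suc u_Suc[abs_def] by (intro depends_on_diff depends_on_scaleR)
  qed
qed

lemma depends_on_g: "(\<And>j i. j \<le> k \<Longrightarrow> (j, i) \<in> J) \<Longrightarrow> depends_on D X J (g k)"
  by (intro depends_on_g_u depends_on_u) auto

lemma depends_on_F: "depends_on D X J Y \<Longrightarrow> depends_on D X J (\<lambda>\<omega>. F (Y \<omega>))"
  by (rule depends_on_comp[OF _ F_measurable])

lemma depends_on_n: "(\<And>j i. j \<le> k \<Longrightarrow> (j, i) \<in> J) \<Longrightarrow> depends_on D X J (n k)"
  unfolding n_def by (intro depends_on_diff depends_on_g depends_on_F depends_on_u) auto

lemma depends_on_N: "\<lbrakk>\<And>j i. j < k \<Longrightarrow> (j, i) \<in> J; (k, i) \<in> J\<rbrakk> \<Longrightarrow> depends_on D X J (N k i)"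
  unfolding N_def by (intro depends_on_diff depends_on_Ft depends_on_F depends_on_u) auto

section \<open>Integrability, orthogonality and variance of the batch noise\<close>

lemma si_N: "i < B \<Longrightarrow> square_integrable M (N k i)"
  using depends_on_measurable[OF depends_on_N[of k UNIV i] X_measurable] estimator_at(2)
  by (simp add: square_integrable_def)

lemma si_n: "square_integrable M (n k)"
  unfolding n_eq by (intro square_integrable_scaleR square_integrable_sum si_N) auto

lemma si_u: "square_integrable M (u k)"
proof (induction k rule: less_induct)
  case (less k)
  show ?case
  proof (cases k)
    case 0
    then show ?thesis by (simp add: u_0[abs_def])
  next
    case (Suc j)
    then have "square_integrable M (u j)" "square_integrable M (u (j - 1))" using less.IH by auto
    then show ?thesis
      unfolding Suc u_Suc[abs_def] g_eq
      by (intro square_integrable_diff square_integrable_scaleR square_integrable_add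
          square_integrable_lipschitz[OF lip] si_n)
  qed
qed

lemma si_F: "square_integrable M (\<lambda>\<omega>. F (u k \<omega>))"
  using lip si_u by (rule square_integrable_lipschitz)

lemma si_g: "square_integrable M (g k)"
  unfolding g_eq[abs_def] by (intro square_integrable_add si_F si_n)

text \<open>The iterate \<open>u k\<close> uses samples of earlier iterations only, so the sample
  \<open>(k, i)\<close> is fresh for it as well as for \<open>Y\<close>.\<close>

lemma N_orthogonal:
  assumes "i < B" "depends_on D X (UNIV - {(k, i)}) Y" "square_integrable M Y"
  shows "ip M (N k i) Y = 0"
proof -
  have "ip M (\<lambda>\<omega>. Ft (u k \<omega>) (X (k, i) \<omega>) - F (u k \<omega>)) Y = 0"
  proof (rule fresh_noise_orthogonal)
    show "(k, i) \<notin> UNIV - {(k, i)}" by simp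
    show "depends_on D X (UNIV - {(k, i)}) (u k)" by (rule depends_on_u) auto
  qed (use assms estimator_at(1) si_N[of i k] in \<open>simp_all add: N_def F_measurable Ft_measurable\<close>)
  then show ?thesis by (simp add: N_def)
qed

lemma n_orthogonal:
  assumes "\<And>i. i < B \<Longrightarrow> depends_on D X (UNIV - {(k, i)}) Y" "square_integrable M Y"
  shows "ip M (n k) Y = 0"
proof -
  have "ip M (\<lambda>\<omega>. \<Sum>i<B. N k i \<omega>) Y = (\<Sum>i<B. ip M (N k i) Y)"
    using assms by (intro ip_sum_left si_N) auto
  then show ?thesis unfolding n_eq using assms by (simp add: ip_scaleR_left N_orthogonal)
qed

text \<open>Noises of one batch share the point \<open>u k\<close>, yet \<open>N k j\<close> is a
  function of samples other than \<open>(k, i)\<close> when \<open>j \<noteq> i\<close>. The cross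
  terms vanish, and averaging divides the variance by \<open>B\<close>.\<close>

lemma n_variance: "ip M (n k) (n k) \<le> \<sigma>\<^sup>2 / real B"
proof -
  have orth: "ip M (N k j) (N k i) = (if j = i then ip M (N k i) (N k i) else 0)"
    if "i < B" "j < B" for i j
  proof (cases "j = i")
    case False
    then show ?thesis using that by (auto intro!: N_orthogonal depends_on_N si_N)
  qed simp
  have si: "square_integrable M (\<lambda>\<omega>. \<Sum>j<B. N k j \<omega>)"
    by (intro square_integrable_sum si_N) auto
  have "ip M (n k) (n k) = (1 / real B)\<^sup>2 * (\<Sum>i<B. \<Sum>j<B. ip M (N k j) (N k i))"
  proof -
    let ?S = "\<lambda>\<omega>. \<Sum>j<B. N k j \<omega>"
    have "ip M (n k) (n k) = (1 / real B)\<^sup>2 * ip M ?S ?S"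
      by (simp add: n_eq ip_scaleR_left ip_scaleR_right power2_eq_square)
    also have "ip M ?S ?S = (\<Sum>i<B. ip M (N k i) ?S)"
      using si by (intro ip_sum_left si_N) auto
    also have "\<dots> = (\<Sum>i<B. ip M ?S (N k i))" by (subst ip_commute) (rule refl)
    also have "\<dots> = (\<Sum>i<B. \<Sum>j<B. ip M (N k j) (N k i))"
      by (intro sum.cong refl ip_sum_left si_N) auto
    finally show ?thesis .
  qed
  also have "(\<Sum>i<B. \<Sum>j<B. ip M (N k j) (N k i)) = (\<Sum>i<B. ip M (N k i) (N k i))"
  proof (rule sum.cong[OF refl])
    fix i assume i: "i \<in> {..<B}"
    have "(\<Sum>j<B. ip M (N k j) (N k i)) = (\<Sum>j<B. if j = i then ip M (N k i) (N k i) else 0)"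
      using i by (intro sum.cong refl orth) auto
    then show "(\<Sum>j<B. ip M (N k j) (N k i)) = ip M (N k i) (N k i)" using i by simp
  qed
  also have "(1 / real B)\<^sup>2 * (\<Sum>i<B. ip M (N k i) (N k i)) \<le> (1 / real B)\<^sup>2 * (\<Sum>i<B. \<sigma>\<^sup>2)"
    by (intro mult_left_mono sum_mono) (use estimator_at(3) in \<open>simp_all add: ip_self_eq\<close>)
  finally show ?thesis using B by (simp add: power2_eq_square)
qed

lemma fh_close: "norm (F (u (Suc k) \<omega>) - fh k \<omega>) \<le> L * a * (1 + \<gamma>) * norm (n k \<omega>)"
proof -
  have L: "0 \<le> L" using lip by (rule lipschitz_on_nonneg)
  have a0: "0 \<le> a" using a(1) minty by (simp add: weak_minty_solution_def)
  let ?y = "if k = 0 then u0 - (a * \<gamma>) *\<^sub>R F u0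
    else u k \<omega> - a *\<^sub>R ((1 + \<gamma>) *\<^sub>R F (u k \<omega>) - g (k - 1) \<omega>)"
  \<comment> \<open>In the first step the estimator enters with net factor \<open>\<gamma>\<close>,
    later with \<open>1 + \<gamma>\<close>.\<close>
  have "u (Suc k) \<omega> - ?y = - ((a * (if k = 0 then \<gamma> else 1 + \<gamma>)) *\<^sub>R n k \<omega>)"
    by (simp add: u_Suc u_0 g_eq[of k] algebra_simps) (simp add: g_eq[of 0] u_0 algebra_simps)
  then have "norm (u (Suc k) \<omega> - ?y) = a * (if k = 0 then \<gamma> else 1 + \<gamma>) * norm (n k \<omega>)"
    using a0 \<gamma> by (simp del: if_split add: abs_mult)
  also have "\<dots> \<le> a * (1 + \<gamma>) * norm (n k \<omega>)"
    using a0 \<gamma> by (intro mult_right_mono mult_left_mono) auto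
  finally have "L * norm (u (Suc k) \<omega> - ?y) \<le> L * (a * (1 + \<gamma>) * norm (n k \<omega>))"
    using L by (intro mult_left_mono)
  moreover have "norm (F (u (Suc k) \<omega>) - fh k \<omega>) \<le> L * norm (u (Suc k) \<omega> - ?y)"
    using lipschitz_onD[OF lip, of "u (Suc k) \<omega>" ?y] by (simp add: fh_def dist_norm)
  ultimately show ?thesis by (simp add: mult_ac)
qed

text \<open>Removing the k-th noise leaves only samples of iterations before \<open>k\<close>; this
  makes \<open>fh k\<close> orthogonal to \<open>n k\<close>.\<close>

lemma depends_on_fh:
  assumes "\<And>j i. j < k \<Longrightarrow> (j, i) \<in> J"
  shows "depends_on D X J (fh k)"
proof (cases "k = 0")
  case False
  then show ?thesis unfolding fh_def using assms
    by (auto intro!: depends_on_F depends_on_diff depends_on_scaleR depends_on_u depends_on_g)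
qed (simp add: fh_def)

lemma si_fh: "square_integrable M (fh k)"
proof (cases "k = 0")
  case False
  then show ?thesis unfolding fh_def
    by (auto intro!: square_integrable_lipschitz[OF lip] square_integrable_diff square_integrable_scaleR
        si_u si_F si_g)
qed (simp add: fh_def)

sublocale noisy_ogda M F L \<rho> a \<gamma> "\<sigma>\<^sup>2 / real B" ustar u n fh
proof unfold_locales
  show "u (Suc k) \<omega> = u k \<omega> -
      a *\<^sub>R ((1 + \<gamma>) *\<^sub>R (F (u k \<omega>) + n k \<omega>) - (F (u (k - 1) \<omega>) + n (k - 1) \<omega>))" for k \<omega>
    by (simp only: u_Suc g_eq)
  show "ip M (n k) (\<lambda>\<omega>. u k \<omega> - ustar) = 0" for k
    by (intro n_orthogonal depends_on_diff depends_on_u depends_on_const square_integrable_diff si_u) auto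
  show "ip M (n k) (\<lambda>\<omega>. F (u j \<omega>)) = 0" if "j \<le> k" for k j
    using that by (intro n_orthogonal depends_on_F depends_on_u si_F) auto
  show "ip M (n k) (n j) = 0" if "j < k" for k j
    using that by (intro n_orthogonal depends_on_n si_n) auto
  show "ip M (n k) (fh k) = 0" for k
    by (intro n_orthogonal depends_on_fh si_fh) auto
qed (fact lip minty L_\<rho> \<gamma> a si_u si_n si_fh fh_close n_variance)+

lemma V0_eq: "V 0 = (\<integral>\<omega>. (norm (u0 + a *\<^sub>R batch_estimator Ft \<xi> B 0 u0 \<omega> - ustar))\<^sup>2 \<partial>M)"
  by (simp add: V_def ip_self_eq z_def f_def u_0 g_eq[of 0, unfolded u_0, symmetric] g_def)

lemma \<phi>_eq: "\<phi> k = (\<integral>\<omega>. (norm (F (u k \<omega>)))\<^sup>2 \<partial>M)"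
  by (simp add: \<phi>_def ip_self_eq f_def)

lemma V0_nonneg: "0 \<le> V 0" by (simp add: V_def)

theorem complexity:
  fixes q \<epsilon> :: real
  assumes q: "a * L \<le> q" "q < 1" and \<epsilon>: "0 < \<epsilon>"
    and B_large: "13 * \<sigma>\<^sup>2 / ((1 - q)\<^sup>2 * (a * L) * \<epsilon>) \<le> real B"
  obtains k where "1 \<le> k" "\<exists>i<k. \<phi> i \<le> \<epsilon>" "real (k - 1) \<le> V 0 / (\<epsilon> * a * \<gamma> * (a - \<rho>))"
\<comment> \<open>If \<open>u 0\<close> already qualifies, \<open>k = 1\<close> costs no call.
  Otherwise \<open>V 0 > 0\<close>, and the rounded-up count exceeds its bound by less than one,
  which \<open>k - 1\<close> compensates.\<close>
proof (cases "\<phi> 0 \<le> \<epsilon>")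
  case True
  then show ?thesis
    using V0_nonneg a a_pos \<gamma> \<epsilon> by (intro that[of 1]) auto
next
  case False
  let ?Q = "V 0 / (\<epsilon> * a * \<gamma> * (a - \<rho>))"
  have "0 < \<phi> 0 * (1 / L\<^sup>2)" using False \<epsilon> L_pos by simp
  then have Q: "0 < ?Q" using V0_lower_bound a a_pos \<gamma> \<epsilon> by (intro divide_pos_pos) auto
  define m where "m = nat \<lceil>?Q\<rceil> - 1"
  have m: "?Q \<le> real (Suc m)" "real m \<le> ?Q" using Q by (simp_all add: m_def) linarith+
  have "\<exists>i\<le>m. \<phi> i \<le> \<epsilon>"
  proof (rule ogda_stopping[OF sum_bound V0_lower_bound \<rho>_pos a(1) L_pos \<gamma>(1) q _ \<epsilon> s_nonneg _ m(1)])
    show "(a * L)\<^sup>2 * (1 + \<gamma>) \<le> a * L" using ogda_slack[OF aL \<gamma>(1)] by simp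
    have "0 < (1 - q)\<^sup>2 * (a * L) * \<epsilon>" using q aL \<epsilon> by simp
    then show "\<sigma>\<^sup>2 / real B \<le> (1 - q)\<^sup>2 * (a * L) * \<epsilon> / 13"
      using B_large B by (simp add: field_simps)
  qed
  then show ?thesis using m by (intro that[of "Suc m"]) (auto simp: less_Suc_eq_le)
qed

end

section \<open>Choice of the batch size and count of oracle calls\<close>

theorem theorem3p3:
  fixes q :: real
  assumes "q < 1"
  shows "\<exists>C>0. \<forall>(F :: 'a::euclidean_space \<Rightarrow> 'a) L \<rho> ustar a \<gamma> \<sigma> u0
      (M :: 'w measure) (D :: 's measure) \<xi> Ft u.
    L-lipschitz_on UNIV F \<and>
    weak_minty_solution F \<rho> ustar \<and>
    1 / L > \<rho> \<and>
    0 < \<gamma> \<and> \<gamma> \<le> 1 \<and>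
    \<rho> < a \<and> a < (1 - \<gamma>) / (1 + \<gamma>) * (1 / L) \<and>
    a * L \<le> q \<and>
    u = ogda_plus Ft \<xi> a \<gamma> u0 \<and>
    stochastic_oracle M D \<xi> Ft F \<sigma> u \<longrightarrow>
    (\<exists>(B :: real \<Rightarrow> nat) (k :: real \<Rightarrow> nat).
       (\<lambda>\<epsilon>. real (B \<epsilon>)) \<in> O[at_right 0](\<lambda>\<epsilon>. 1 / \<epsilon>) \<and>
       (\<forall>\<epsilon>>0.
          B \<epsilon> \<ge> 1 \<and> k \<epsilon> \<ge> 1 \<and>
          (\<forall>i<k \<epsilon>. integrable M (\<lambda>\<omega>. (norm (F (u (B \<epsilon>) i \<omega>)))\<^sup>2)) \<and>
          (MIN i\<in>{0..k \<epsilon> - 1}. \<integral>\<omega>. (norm (F (u (B \<epsilon>) i \<omega>)))\<^sup>2 \<partial>M) \<le> \<epsilon> \<and>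
          real (oracle_calls (B \<epsilon>) (k \<epsilon> - 1)) \<le>
            C * (1 / \<epsilon> * (1 / (a * \<gamma> * (a - \<rho>))) *
                 (\<integral>\<omega>. (norm (u0 + a *\<^sub>R batch_estimator Ft \<xi> (B \<epsilon>) 0 u0 \<omega> - ustar))\<^sup>2 \<partial>M) *
                 max 1 (4 * \<sigma>\<^sup>2 / (a * L) * (1 / \<epsilon>)))))"
proof (intro exI[of _ "1 + 13 / (4 * (1 - q)\<^sup>2)"] conjI allI impI, goal_cases)
  case 1
  then show ?case by (simp add: add_pos_nonneg)
next
  case (2 F L \<rho> ustar a \<gamma> \<sigma> u0 M D \<xi> Ft u)
  then have u: "u = ogda_plus Ft \<xi> a \<gamma> u0" and q: "a * L \<le> q" by simp_all
  have run: "ogda_run M D \<xi> Ft F L \<rho> a \<gamma> \<sigma> u0 ustar b" if "1 \<le> b" for b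
    using 2 that unfolding ogda_run_def ogda_run_axioms_def
    by (auto simp: stochastic_oracle_def iid_samples_def)
  have aL: "0 < a * L" and a0: "0 < a" "0 < a - \<rho>" and \<gamma>: "0 < \<gamma>"
  proof -
    \<comment> \<open>These parameter inequalities do not involve the batch size, so a run with
      batch size 1 supplies them.\<close>
    interpret ogda_run M D \<xi> Ft F L \<rho> a \<gamma> \<sigma> u0 ustar 1 by (rule run) simp
    show "0 < a * L" "0 < a" "0 < a - \<rho>" "0 < \<gamma>" using aL a_pos a \<gamma> by auto
  qed
  define T where "T = 13 * \<sigma>\<^sup>2 / ((1 - q)\<^sup>2 * (a * L))"
  have T: "0 \<le> T" using aL by (simp add: T_def)
  \<comment> \<open>The least batch size of at least 1 satisfying \<open>B_large\<close> of
    \<open>complexity\<close>. It stays below \<open>1 + T / \<epsilon>\<close>, which serves both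
    the order in \<open>\<epsilon>\<close> and the call count.\<close>
  define B where "B \<epsilon> = max 1 (nat \<lceil>T / \<epsilon>\<rceil>)" for \<epsilon> :: real
  define V0 where "V0 b = (\<integral>\<omega>. (norm (u0 + a *\<^sub>R batch_estimator Ft \<xi> b 0 u0 \<omega> - ustar))\<^sup>2 \<partial>M)" for b
  have B1: "1 \<le> B \<epsilon>" for \<epsilon> by (simp add: B_def)
  have B_lower: "T / \<epsilon> \<le> real (B \<epsilon>)" for \<epsilon> by (simp add: B_def) linarith
  have B_upper: "real (B \<epsilon>) \<le> 1 + T / \<epsilon>" if "0 < \<epsilon>" for \<epsilon>
  proof -
    have "0 \<le> T / \<epsilon>" using T that by simp
    then show ?thesis unfolding B_def by linarith
  qed
  have bigo: "(\<lambda>\<epsilon>. real (B \<epsilon>)) \<in> O[at_right 0](\<lambda>\<epsilon>. 1 / \<epsilon>)"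
  proof (rule bigoI[where c = "1 + T"])
    have "eventually (\<lambda>\<epsilon>::real. \<epsilon> \<in> {0<..<1}) (at_right 0)"
      by (rule eventually_at_right_real) simp
    then show "eventually (\<lambda>\<epsilon>. norm (real (B \<epsilon>)) \<le> (1 + T) * norm (1 / \<epsilon>)) (at_right 0)"
    proof eventually_elim
      case (elim \<epsilon>)
      then have "1 + T / \<epsilon> \<le> (1 + T) * (1 / \<epsilon>)" by (simp add: field_simps)
      then show ?case using B_upper[of \<epsilon>] elim by simp
    qed
  qed
  have "\<exists>k\<ge>1. (\<forall>i<k. integrable M (\<lambda>\<omega>. (norm (F (u (B \<epsilon>) i \<omega>)))\<^sup>2)) \<and>
      (MIN i\<in>{0..k - 1}. \<integral>\<omega>. (norm (F (u (B \<epsilon>) i \<omega>)))\<^sup>2 \<partial>M) \<le> \<epsilon> \<and>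
      real (k - 1) \<le> V0 (B \<epsilon>) / (\<epsilon> * a * \<gamma> * (a - \<rho>))" if \<epsilon>: "0 < \<epsilon>" for \<epsilon>
  proof -
    interpret R: ogda_run M D \<xi> Ft F L \<rho> a \<gamma> \<sigma> u0 ustar "B \<epsilon>" by (rule run[OF B1])
    have "13 * \<sigma>\<^sup>2 / ((1 - q)\<^sup>2 * (a * L) * \<epsilon>) \<le> real (B \<epsilon>)"
      using B_lower[of \<epsilon>] by (simp add: T_def)
    from R.complexity[OF q assms \<epsilon> this]
    obtain k where k: "1 \<le> k" "\<exists>i<k. R.\<phi> i \<le> \<epsilon>"
        "real (k - 1) \<le> R.V 0 / (\<epsilon> * a * \<gamma> * (a - \<rho>))" .
    obtain i where i: "i < k" "R.\<phi> i \<le> \<epsilon>" using k(2) by blast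
    have "(MIN i\<in>{0..k - 1}. \<integral>\<omega>. (norm (F (u (B \<epsilon>) i \<omega>)))\<^sup>2 \<partial>M) \<le> R.\<phi> i"
      using i by (intro Min_le) (auto simp: R.\<phi>_eq R.u_def u)
    moreover have "integrable M (\<lambda>\<omega>. (norm (F (u (B \<epsilon>) j \<omega>)))\<^sup>2)" for j
      using R.si_F[of j] by (simp add: square_integrable_def R.u_def u)
    ultimately show ?thesis
      using k i by (intro exI[of _ k]) (auto simp: V0_def R.V0_eq)
  qed
  then obtain k where k: "\<And>\<epsilon>. 0 < \<epsilon> \<Longrightarrow> 1 \<le> k \<epsilon>"
    "\<And>\<epsilon> i. \<lbrakk>0 < \<epsilon>; i < k \<epsilon>\<rbrakk> \<Longrightarrow> integrable M (\<lambda>\<omega>. (norm (F (u (B \<epsilon>) i \<omega>)))\<^sup>2)"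
    "\<And>\<epsilon>. 0 < \<epsilon> \<Longrightarrow> (MIN i\<in>{0..k \<epsilon> - 1}. \<integral>\<omega>. (norm (F (u (B \<epsilon>) i \<omega>)))\<^sup>2 \<partial>M) \<le> \<epsilon>"
    "\<And>\<epsilon>. 0 < \<epsilon> \<Longrightarrow> real (k \<epsilon> - 1) \<le> V0 (B \<epsilon>) / (\<epsilon> * a * \<gamma> * (a - \<rho>))"
    by metis
  \<comment> \<open>The quotient \<open>13 / (4 * (1 - q)\<^sup>2)\<close> relates
    \<open>T / \<epsilon>\<close> to the second argument of the maximum, and the summand 1 covers
    the rounding of the batch size. The call count is batch size times
    \<open>k \<epsilon> - 1\<close>.\<close>
  have calls: "real (oracle_calls (B \<epsilon>) (k \<epsilon> - 1)) \<le> (1 + 13 / (4 * (1 - q)\<^sup>2)) *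
      (1 / \<epsilon> * (1 / (a * \<gamma> * (a - \<rho>))) * V0 (B \<epsilon>) * max 1 (4 * \<sigma>\<^sup>2 / (a * L) * (1 / \<epsilon>)))"
    if \<epsilon>: "0 < \<epsilon>" for \<epsilon>
  proof -
    let ?m = "max 1 (4 * \<sigma>\<^sup>2 / (a * L) * (1 / \<epsilon>))" and ?Q = "V0 (B \<epsilon>) / (\<epsilon> * a * \<gamma> * (a - \<rho>))"
    have "T / \<epsilon> = 13 / (4 * (1 - q)\<^sup>2) * (4 * \<sigma>\<^sup>2 / (a * L) * (1 / \<epsilon>))"
      using aL by (simp add: T_def)
    also have "\<dots> \<le> 13 / (4 * (1 - q)\<^sup>2) * ?m" by (intro mult_left_mono) auto
    finally have "real (B \<epsilon>) \<le> (1 + 13 / (4 * (1 - q)\<^sup>2)) * ?m"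
      using B_upper[OF \<epsilon>] by (simp add: distrib_right)
    then have "real (B \<epsilon>) * real (k \<epsilon> - 1) \<le> (1 + 13 / (4 * (1 - q)\<^sup>2)) * ?m * ?Q"
      using k(4)[OF \<epsilon>] by (intro mult_mono) auto
    then show ?thesis by (simp add: oracle_calls_def mult_ac)
  qed
  show ?case
    using bigo B1 k calls by (intro exI[of _ B] exI[of _ k]) (auto simp: V0_def)
qed

end
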